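(* Let $(\mathcal{M},d,0)$ be a pointed metric space and let $\alpha\colon(0,\infty)\to(0,\infty)$ be a Lipschitz map with $D(\alpha)(K(\alpha)+2)\le1$. Equip the real Banach space $\mathrm{Lip}_0(\mathcal{M})$ with the multiplication $\odot_\alpha$. A subalgebra $Y\subset\mathrm{Lip}_0(\mathcal{M})$ is order complete if and only if it is $w^*$-closed. Moreover, if $Y$ is order complete then: (i) $Y$ is a linear complete sublattice. (ii) If $\mathrm{Lip}_0(\mathcal{M})$ has a natural unit, then $f\vee(g-c\,\zeta)\in Y$ for all $f,g\in Y$ and all $c\ge0$.
   Context: All spaces are real. $\mathrm{Lip}_0(\mathcal{M})$ is the Banach space of real Lipschitz functions on $\mathcal{M}$ vanishing at the base point $0$, with norm $\mathrm{Lip}(f)=\sup_{x\neq y}|f(x)-f(y)|/d(x,y)$. The $w^*$-topology on it comes from the identification $\mathrm{Lip}_0(\mathcal{M})=\mathcal{F}(\mathcal{M})^*$, where $\mathcal{F}(\mathcal{M})$ is the Lipschitz-free space over $\mathcal{M}$, i.e. the closed linear span in $\mathrm{Lip}_0(\mathcal{M})^*$ of the evaluations $\delta_{\mathcal{M}}(x)\colon f\mapsto f(x)$. $\mathrm{Lip}(\alpha)$ is the least Lipschitz constant of $\alpha$, $D(\alpha)=\sup_{t>0}t/\alpha(t)$, $K(\alpha)=\mathrm{Lip}(\alpha)D(\alpha)$. Put $\zeta(0)=0$ and $\zeta(x)=\alpha(d(0,x))$ for $x\neq0$. The product $\odot_\alpha$ is $(f\odot_\alpha g)(x)=f(x)g(x)/\zeta(x)$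 for $x\ne0$ and $(f\odot_\alpha g)(0)=0$; it makes $\mathrm{Lip}_0(\mathcal{M})$ a Banach algebra. "$\mathrm{Lip}_0(\mathcal{M})$ has a natural unit" means that this algebra has a unit, which is then necessarily $\zeta$. A subalgebra is a linear subspace closed under $\odot_\alpha$. It is order complete if it is stable under pointwise convergence of norm-bounded (pointwise) increasing nets. It is a linear complete sublattice if it is closed under taking the pointwise supremum of an arbitrary, possibly infinite, (nonempty) set of functions that are uniformly bounded in the Lipschitz norm. $\vee$ denotes pointwise maximum. *)

theory Defs
  imports "HOL-Analysis.Analysis"
begin

section \<open>The Banach space of Lipschitz functions vanishing at the base point\<close>

text \<open>A pointed metric space is a type of sort \<open>{metric_space, zero}\<close>: the class \<open>zero\<close> has no
  axioms, it only singles out an element \<open>0\<close>, which serves as the base point.\<close>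

typedef (overloaded) ('a :: "{metric_space, zero}") lip0 =
  "{f :: 'a \<Rightarrow> real. f 0 = 0 \<and> (\<exists>C. C-lipschitz_on UNIV f)}"
  morphisms lip_apply Abs_lip0
  by (rule exI[of _ "\<lambda>_. 0"]) (auto intro: lipschitz_on_constant)

setup_lifting type_definition_lip0

lemma lip0_eqI: "(\<And>x. lip_apply f x = lip_apply g x) \<Longrightarrow> f = g"
  by (metis ext lip_apply_inject)

lemma lip_apply_0 [simp]: "lip_apply f 0 = 0"
  using lip_apply[of f] by simp

lemma lip_apply_lipschitz: "\<exists>C. C-lipschitz_on UNIV (lip_apply f)"
  using lip_apply[of f] by simp

instantiation lip0 :: ("{metric_space, zero}") real_vector
begin

lift_definition zero_lip0 :: "'a lip0" is "\<lambda>_. 0"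
  by (auto intro: lipschitz_on_constant)

lift_definition plus_lip0 :: "'a lip0 \<Rightarrow> 'a lip0 \<Rightarrow> 'a lip0" is "\<lambda>f g x. f x + g x"
  by (auto intro: lipschitz_on_add)

lift_definition uminus_lip0 :: "'a lip0 \<Rightarrow> 'a lip0" is "\<lambda>f x. - f x"
  by (auto intro: lipschitz_on_minus)

lift_definition minus_lip0 :: "'a lip0 \<Rightarrow> 'a lip0 \<Rightarrow> 'a lip0" is "\<lambda>f g x. f x - g x"
  by (auto intro: lipschitz_on_diff)

lift_definition scaleR_lip0 :: "real \<Rightarrow> 'a lip0 \<Rightarrow> 'a lip0" is "\<lambda>c f x. c * f x"
  by (auto intro: lipschitz_on_cmult_real)

instance
  by standard (transfer; simp add: fun_eq_iff algebra_simps)+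

end

lemma lip_apply_zero [simp]: "lip_apply 0 x = 0"
  by transfer simp

lemma lip_apply_add [simp]: "lip_apply (f + g) x = lip_apply f x + lip_apply g x"
  by transfer simp

lemma lip_apply_uminus [simp]: "lip_apply (- f) x = - lip_apply f x"
  by transfer simp

lemma lip_apply_diff [simp]: "lip_apply (f - g) x = lip_apply f x - lip_apply g x"
  by transfer simp

lemma lip_apply_scaleR [simp]: "lip_apply (c *\<^sub>R f) x = c * lip_apply f x"
  by transfer simp

text \<open>In the norm below, the pairs with \<open>x = y\<close> contribute \<open>0 / 0 = 0\<close>. Hence they do not change
  the supremum over \<open>x \<noteq> y\<close>, except that it becomes \<open>0\<close> on a one-point space.\<close>

instantiation lip0 :: ("{metric_space, zero}") real_normed_vector
begin

definition norm_lip0 :: "'a lip0 \<Rightarrow> real" where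
  "norm_lip0 f = (SUP (x, y). \<bar>lip_apply f x - lip_apply f y\<bar> / dist x y)"

definition dist_lip0 :: "'a lip0 \<Rightarrow> 'a lip0 \<Rightarrow> real" where
  "dist_lip0 f g = norm (f - g)"

definition sgn_lip0 :: "'a lip0 \<Rightarrow> 'a lip0" where
  "sgn_lip0 f = f /\<^sub>R norm f"

definition uniformity_lip0 :: "('a lip0 \<times> 'a lip0) filter" where
  "uniformity_lip0 = (INF e\<in>{0<..}. principal {(x, y). dist x y < e})"

definition open_lip0 :: "'a lip0 set \<Rightarrow> bool" where
  "open_lip0 S = (\<forall>x\<in>S. \<forall>\<^sub>F (x', y) in uniformity. x' = x \<longrightarrow> y \<in> S)"

lemma lip0_bdd_above:
  "bdd_above (range (\<lambda>(x, y). \<bar>lip_apply f x - lip_apply f y\<bar> / dist x y))"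
proof -
  obtain C where C: "C-lipschitz_on UNIV (lip_apply f)"
    using lip_apply_lipschitz by blast
  have "\<bar>lip_apply f x - lip_apply f y\<bar> / dist x y \<le> C" for x y
    using lipschitz_onD[OF C, of x y] lipschitz_on_nonneg[OF C]
    by (cases "x = y") (auto simp: dist_real_def divide_le_eq)
  then show ?thesis
    by (intro bdd_aboveI[of _ C]) auto
qed

lemma lip0_diff_le: "\<bar>lip_apply f x - lip_apply f y\<bar> \<le> norm f * dist x y"
proof (cases "x = y")
  case False
  have "\<bar>lip_apply f x - lip_apply f y\<bar> / dist x y \<le> norm f"
    unfolding norm_lip0_def using cSUP_upper[OF UNIV_I lip0_bdd_above[of f], of "(x, y)"] by simp
  with False show ?thesis
    by (simp add: divide_le_eq)
qed simp

lemma norm_lip0_leI: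
  assumes "0 \<le> C" "\<And>x y. \<bar>lip_apply f x - lip_apply f y\<bar> \<le> C * dist x y"
  shows "norm f \<le> C"
  unfolding norm_lip0_def
proof (rule cSUP_least)
  fix p :: "'a \<times> 'a"
  show "(case p of (x, y) \<Rightarrow> \<bar>lip_apply f x - lip_apply f y\<bar> / dist x y) \<le> C"
    using assms(2)[of "fst p" "snd p"] assms(1)
    by (cases "fst p = snd p") (auto simp: case_prod_beta divide_le_eq)
qed simp

lemma norm_lip0_nonneg: "0 \<le> norm (f :: 'a lip0)"
  unfolding norm_lip0_def using cSUP_upper[OF UNIV_I lip0_bdd_above[of f], of "(0, 0)"] by simp

instance
proof
  fix f g :: "'a lip0" and c :: real
  show "norm f = 0 \<longleftrightarrow> f = 0"
  proof
    assume "norm f = 0"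
    then have "lip_apply f x = 0" for x
      using lip0_diff_le[of f x 0] by simp
    then show "f = 0"
      by (intro lip0_eqI) simp
  next
    assume "f = 0"
    then have "norm f \<le> 0"
      by (intro norm_lip0_leI) auto
    then show "norm f = 0"
      using norm_lip0_nonneg[of f] by simp
  qed
  show "norm (f + g) \<le> norm f + norm g"
  proof (rule norm_lip0_leI)
    show "\<bar>lip_apply (f + g) x - lip_apply (f + g) y\<bar> \<le> (norm f + norm g) * dist x y" for x y
      using lip0_diff_le[of f x y] lip0_diff_le[of g x y] by (simp add: distrib_right)
  qed (simp add: norm_lip0_nonneg)
  have le: "norm (a *\<^sub>R h) \<le> \<bar>a\<bar> * norm h" for a :: real and h :: "'a lip0"
  proof (rule norm_lip0_leI)
    show "\<bar>lip_apply (a *\<^sub>R h) x - lip_apply (a *\<^sub>R h) y\<bar> \<le> \<bar>a\<bar> * norm h * dist x y" for x y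
      using mult_left_mono[OF lip0_diff_le[of h x y], of "\<bar>a\<bar>"]
      by (simp add: abs_mult mult.assoc flip: right_diff_distrib)
  qed (simp add: norm_lip0_nonneg)
  show "norm (c *\<^sub>R f) = \<bar>c\<bar> * norm f"
  proof (cases "c = 0")
    case False
    have "norm f \<le> \<bar>inverse c\<bar> * norm (c *\<^sub>R f)"
      using le[of "inverse c" "c *\<^sub>R f"] False by simp
    then have "\<bar>c\<bar> * norm f \<le> norm (c *\<^sub>R f)"
      using False by (simp add: field_simps)
    with le[of c f] show ?thesis by simp
  next
    case True
    then show ?thesis
      using le[of 0 f] norm_lip0_nonneg[of "c *\<^sub>R f"] by simp
  qed
qed (simp_all add: dist_lip0_def sgn_lip0_def uniformity_lip0_def open_lip0_def)

end


section \<open>The Lipschitz-free space and the weak-star topology\<close>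

lift_definition lip_eval :: "'a :: {metric_space, zero} \<Rightarrow> 'a lip0 \<Rightarrow>\<^sub>L real"
  is "\<lambda>x f. lip_apply f x"
proof -
  fix x :: 'a
  show "bounded_linear (\<lambda>f :: 'a lip0. lip_apply f x)"
    by (rule bounded_linear_intro[where K = "dist x 0"])
      (use lip0_diff_le[of _ x 0] in \<open>simp_all\<close>)
qed

definition lip_free :: "('a :: {metric_space, zero} lip0 \<Rightarrow>\<^sub>L real) set" where
  "lip_free = closure (span (range lip_eval))"

text \<open>The identification of \<open>Lip\<^sub>0(M)\<close> with the dual of \<open>lip_free\<close> sends \<open>f\<close> to the functional
  \<open>\<mu> \<mapsto> \<mu> f\<close>; the weak-star topology is the coarsest one making \<open>f \<mapsto> \<mu> f\<close> continuous for all \<open>\<mu>\<close>.\<close>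

definition lip0_weak_star :: "'a :: {metric_space, zero} lip0 topology" where
  "lip0_weak_star =
     topology_generated_by {blinfun_apply \<mu> -` U | \<mu> U. \<mu> \<in> lip_free \<and> open U}"

lemma topspace_lip0_weak_star [simp]: "topspace lip0_weak_star = UNIV"
proof -
  have "(0 :: 'a lip0 \<Rightarrow>\<^sub>L real) \<in> lip_free"
    unfolding lip_free_def by (intro subsetD[OF closure_subset] span_zero)
  then show ?thesis
    unfolding lip0_weak_star_def topology_generated_by_topspace by (auto intro!: exI[of _ UNIV])
qed


section \<open>The constants attached to the gauge, and the product\<close>

text \<open>A gauge is a map \<open>\<alpha> : (0,\<infinity>) \<rightarrow> (0,\<infinity>)\<close>; only its values at positive reals are used.
  \<open>gauge_D \<alpha>\<close> may be infinite, hence the extended reals.\<close>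

definition gauge_Lip :: "(real \<Rightarrow> real) \<Rightarrow> real" where
  "gauge_Lip \<alpha> = Inf {L. L-lipschitz_on {0<..} \<alpha>}"

definition gauge_D :: "(real \<Rightarrow> real) \<Rightarrow> ennreal" where
  "gauge_D \<alpha> = (SUP t\<in>{0<..}. ennreal (t / \<alpha> t))"

definition gauge_K :: "(real \<Rightarrow> real) \<Rightarrow> ennreal" where
  "gauge_K \<alpha> = ennreal (gauge_Lip \<alpha>) * gauge_D \<alpha>"

definition gauge_zeta :: "(real \<Rightarrow> real) \<Rightarrow> 'a :: {metric_space, zero} \<Rightarrow> real" where
  "gauge_zeta \<alpha> x = (if x = 0 then 0 else \<alpha> (dist 0 x))"

text \<open>The formula below defines an element of \<open>Lip\<^sub>0(M)\<close> when \<open>\<alpha>\<close> is a Lipschitz gauge with finite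
  \<open>gauge_D \<alpha>\<close>; this is \<open>lip_apply_lip_prod\<close>.\<close>

definition lip_prod ::
    "(real \<Rightarrow> real) \<Rightarrow> 'a :: {metric_space, zero} lip0 \<Rightarrow> 'a lip0 \<Rightarrow> 'a lip0" where
  "lip_prod \<alpha> f g =
     Abs_lip0 (\<lambda>x. if x = 0 then 0 else lip_apply f x * lip_apply g x / gauge_zeta \<alpha> x)"

lemma lip_apply_lip_prod:
  fixes f g :: "'a :: {metric_space, zero} lip0"
  assumes pos: "\<And>t. 0 < t \<Longrightarrow> 0 < \<alpha> t" and lip: "L-lipschitz_on {0<..} \<alpha>"
    and fin: "gauge_D \<alpha> < \<infinity>"
  shows "lip_apply (lip_prod \<alpha> f g) x =
    (if x = 0 then 0 else lip_apply f x * lip_apply g x / gauge_zeta \<alpha> x)"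
proof -
  define h where "h x = (if x = 0 then 0 else lip_apply f x * lip_apply g x / gauge_zeta \<alpha> x)" for x
  define d where "d = enn2real (gauge_D \<alpha>)"
  define F G where "F = norm f" and "G = norm g"
  have [simp]: "0 \<le> F" "0 \<le> G" "0 \<le> d" "0 \<le> L"
    using lipschitz_on_nonneg[OF lip] by (auto simp: F_def G_def d_def)
  have dle: "t / \<alpha> t \<le> d" if "0 < t" for t
  proof -
    have "ennreal (t / \<alpha> t) \<le> ennreal d"
      using fin that unfolding d_def by (auto simp: gauge_D_def intro: SUP_upper)
    then show ?thesis by simp
  qed
  have F: "\<bar>lip_apply f y\<bar> \<le> F * dist y 0" and G: "\<bar>lip_apply g y\<bar> \<le> G * dist y 0" for y
    using lip0_diff_le[of f y 0] lip0_diff_le[of g y 0] by (auto simp: F_def G_def)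
  define C where "C = F * G * (2 * d + L * d * d)"
  have C0: "0 \<le> C" unfolding C_def by simp
  have main: "\<bar>h x - h y\<bar> \<le> C * dist x y" if le: "dist y 0 \<le> dist x 0" for x y
  proof (cases "x = 0")
    case True
    with le show ?thesis by simp
  next
    case x: False
    define a where "a = dist x 0"
    define A where "A = \<alpha> a"
    have a: "0 < a" and A: "0 < A" using x pos by (auto simp: a_def A_def)
    have aA: "a / A \<le> d" using dle[OF a] by (simp add: A_def)
    have hx: "h x = lip_apply f x * lip_apply g x / A"
      using x by (simp add: h_def gauge_zeta_def A_def a_def dist_commute)
    have fx: "\<bar>lip_apply f x\<bar> / A \<le> F * d"
    proof -
      have "\<bar>lip_apply f x\<bar> / A \<le> F * a / A"
        using F[of x] A by (intro divide_right_mono) (auto simp: a_def)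
      also have "\<dots> \<le> F * d"
        using mult_left_mono[OF aA, of F] by simp
      finally show ?thesis .
    qed
    have bnd: "u / A \<le> M * d" if "u \<le> M * dist y 0" "0 \<le> M" for u M
    proof -
      have "u \<le> M * a" using that mult_left_mono[OF le, of M] by (simp add: a_def)
      then have "u / A \<le> M * a / A" using A by (intro divide_right_mono) auto
      also have "\<dots> \<le> M * d" using mult_left_mono[OF aA that(2)] by simp
      finally show ?thesis .
    qed
    have fy: "\<bar>lip_apply f y\<bar> / A \<le> F * d" and gy: "\<bar>lip_apply g y\<bar> / A \<le> G * d"
      using bnd[OF F[of y]] bnd[OF G[of y]] by simp_all
    define R where "R = h y - lip_apply f y * lip_apply g y / A"
    have R: "\<bar>R\<bar> \<le> F * G * (L * d * d) * dist x y"
    proof (cases "y = 0")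
      case True
      then show ?thesis by (simp add: R_def h_def)
    next
      case y: False
      define b where "b = dist y 0"
      define B where "B = \<alpha> b"
      have b: "0 < b" and B: "0 < B" using y pos by (auto simp: b_def B_def)
      have hy: "h y = lip_apply f y * lip_apply g y / B"
        using y by (simp add: h_def gauge_zeta_def B_def b_def dist_commute)
      have gB: "\<bar>lip_apply g y\<bar> / B \<le> G * d"
      proof -
        have "\<bar>lip_apply g y\<bar> / B \<le> G * b / B"
          using G[of y] B by (intro divide_right_mono) (auto simp: b_def)
        also have "\<dots> \<le> G * d"
          using mult_left_mono[OF dle[OF b], of G] by (simp add: B_def)
        finally show ?thesis .
      qed
      have AB: "\<bar>A - B\<bar> \<le> L * dist x y"
      proof -
        have "\<bar>A - B\<bar> \<le> L * \<bar>a - b\<bar>"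
          using lipschitz_onD[OF lip, of a b] a b by (simp add: A_def B_def dist_real_def)
        also have "\<bar>a - b\<bar> \<le> dist x y"
          unfolding a_def b_def by (metis abs_dist_diff_le dist_commute)
        finally show ?thesis by (simp add: mult_left_mono)
      qed
      have "R = (lip_apply f y / A) * (lip_apply g y / B) * (A - B)"
        using A B by (simp add: R_def hy field_simps)
      then have "\<bar>R\<bar> = (\<bar>lip_apply f y\<bar> / A) * (\<bar>lip_apply g y\<bar> / B) * \<bar>A - B\<bar>"
        using A B by (simp add: abs_mult)
      also have "\<dots> \<le> (F * d) * (G * d) * (L * dist x y)"
        using fy gB AB A B by (intro mult_mono) auto
      finally show ?thesis by (simp add: mult_ac)
    qed
    have "h x - h y = (lip_apply f x / A) * (lip_apply g x - lip_apply g y)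
        + (lip_apply g y / A) * (lip_apply f x - lip_apply f y) - R"
      by (simp add: R_def hx diff_divide_distrib algebra_simps)
    then have "\<bar>h x - h y\<bar> \<le> \<bar>(lip_apply f x / A) * (lip_apply g x - lip_apply g y)\<bar>
        + \<bar>(lip_apply g y / A) * (lip_apply f x - lip_apply f y)\<bar> + \<bar>R\<bar>"
      by linarith
    also have "\<dots> = (\<bar>lip_apply f x\<bar> / A) * \<bar>lip_apply g x - lip_apply g y\<bar>
        + (\<bar>lip_apply g y\<bar> / A) * \<bar>lip_apply f x - lip_apply f y\<bar> + \<bar>R\<bar>"
      using A by (simp add: abs_mult)
    also have "\<dots> \<le> (F * d) * (G * dist x y) + (G * d) * (F * dist x y)
        + F * G * (L * d * d) * dist x y"
      using fx gy R A lip0_diff_le[of f x y] lip0_diff_le[of g x y]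
      by (intro add_mono mult_mono) (auto simp: F_def G_def)
    also have "\<dots> = C * dist x y"
      by (simp add: C_def algebra_simps)
    finally show ?thesis .
  qed
  have "C-lipschitz_on UNIV h"
  proof (rule lipschitz_onI[OF _ C0])
    fix x y :: 'a
    show "dist (h x) (h y) \<le> C * dist x y"
      using main[of y x] main[of x y] linear[of "dist x 0" "dist y 0"]
      by (auto simp: dist_real_def dist_commute abs_minus_commute)
  qed
  moreover have "h 0 = 0" by (simp add: h_def)
  ultimately have "lip_apply (Abs_lip0 h) = h"
    by (intro Abs_lip0_inverse) auto
  then show ?thesis
    by (simp add: lip_prod_def h_def [abs_def])
qed

definition lip_subalgebra :: "(real \<Rightarrow> real) \<Rightarrow> 'a :: {metric_space, zero} lip0 set \<Rightarrow> bool" where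
  "lip_subalgebra \<alpha> Y \<longleftrightarrow> subspace Y \<and> (\<forall>f\<in>Y. \<forall>g\<in>Y. lip_prod \<alpha> f g \<in> Y)"

definition has_natural_unit ::
    "(real \<Rightarrow> real) \<Rightarrow> 'a :: {metric_space, zero} itself \<Rightarrow> bool" where
  "has_natural_unit \<alpha> _ \<longleftrightarrow>
     (\<exists>e :: 'a lip0. \<forall>f. lip_prod \<alpha> e f = f \<and> lip_prod \<alpha> f e = f)"


section \<open>Order completeness and complete sublattices\<close>

definition directed_by :: "'i set \<Rightarrow> 'i rel \<Rightarrow> bool" where
  "directed_by I r \<longleftrightarrow>
     I \<noteq> {} \<and> preorder_on I r \<and> (\<forall>i\<in>I. \<forall>j\<in>I. \<exists>k\<in>I. (i, k) \<in> r \<and> (j, k) \<in> r)"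

definition net_filter :: "'i set \<Rightarrow> 'i rel \<Rightarrow> 'i filter" where
  "net_filter I r = (INF i\<in>I. principal {j\<in>I. (i, j) \<in> r})"

lemma eventually_net_filter:
  assumes "directed_by I r"
  shows "eventually P (net_filter I r) \<longleftrightarrow> (\<exists>i\<in>I. \<forall>j\<in>I. (i, j) \<in> r \<longrightarrow> P j)"
proof -
  have tr: "trans_on I r \<or> trans r"
    using assms by (simp add: directed_by_def preorder_on_def)
  have "\<exists>k\<in>I. {l\<in>I. (k, l) \<in> r} \<subseteq> {l\<in>I. (i, l) \<in> r} \<inter> {l\<in>I. (j, l) \<in> r}"
    if ij: "i \<in> I" "j \<in> I" for i j
  proof -
    obtain k where "k \<in> I" "(i, k) \<in> r" "(j, k) \<in> r"
      using assms ij unfolding directed_by_def by blast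
    then show ?thesis
      using tr ij by (intro bexI[of _ k]) (auto dest: transD trans_onD)
  qed
  then have "eventually P (net_filter I r) \<longleftrightarrow>
      (\<exists>i\<in>I. eventually P (principal {j\<in>I. (i, j) \<in> r}))"
    unfolding net_filter_def using assms
    by (intro eventually_INF_base) (auto simp: directed_by_def)
  then show ?thesis
    by (auto simp: eventually_principal)
qed

text \<open>A formula cannot quantify over all index types, so the nets below are indexed by subsets of
  the type \<open>'a lip0\<close> (with arbitrary directed preorders). Nothing is lost: an increasing net may be
  replaced by its range, ordered pointwise. Lemma \<open>lip_order_completeD\<close> gives the stability for
  nets over an arbitrary index type.\<close>

definition lip_order_complete :: "'a :: {metric_space, zero} lip0 set \<Rightarrow> bool" where
  "lip_order_complete Y \<longleftrightarrow>
     (\<forall>(I :: 'a lip0 set) r f h.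
        directed_by I r \<and> (\<forall>i\<in>I. f i \<in> Y) \<and> (\<exists>C. \<forall>i\<in>I. norm (f i) \<le> C) \<and>
        (\<forall>i\<in>I. \<forall>j\<in>I. (i, j) \<in> r \<longrightarrow> (\<forall>x. lip_apply (f i) x \<le> lip_apply (f j) x)) \<and>
        (\<forall>x. ((\<lambda>i. lip_apply (f i) x) \<longlongrightarrow> h x) (net_filter I r))
        \<longrightarrow> h \<in> lip_apply ` Y)"

lemma lip_order_completeD:
  fixes Y :: "'a :: {metric_space, zero} lip0 set" and I :: "'i set" and f :: "'i \<Rightarrow> 'a lip0"
  assumes Y: "lip_order_complete Y" and dir: "directed_by I r"
    and fY: "\<And>i. i \<in> I \<Longrightarrow> f i \<in> Y" and bdd: "\<And>i. i \<in> I \<Longrightarrow> norm (f i) \<le> C"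
    and mono: "\<And>i j x. i \<in> I \<Longrightarrow> j \<in> I \<Longrightarrow> (i, j) \<in> r \<Longrightarrow> lip_apply (f i) x \<le> lip_apply (f j) x"
    and lim: "\<And>x. ((\<lambda>i. lip_apply (f i) x) \<longlongrightarrow> h x) (net_filter I r)"
  shows "h \<in> lip_apply ` Y"
proof -
  define J where "J = f ` I"
  define s where "s = {(u, v). u \<in> J \<and> v \<in> J \<and> (\<forall>x. lip_apply u x \<le> lip_apply v x)}"
  have nontriv: "net_filter I r \<noteq> bot"
    using dir unfolding trivial_limit_def eventually_net_filter[OF dir]
    by (auto simp: directed_by_def)
  have le_h: "lip_apply (f i) x \<le> h x" if "i \<in> I" for i x
  proof (rule tendsto_lowerbound[OF lim _ nontriv])
    show "\<forall>\<^sub>F j in net_filter I r. lip_apply (f i) x \<le> lip_apply (f j) x"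
      unfolding eventually_net_filter[OF dir] using that mono by blast
  qed
  have dirJ: "directed_by J s"
    unfolding directed_by_def
  proof (intro conjI ballI)
    show "J \<noteq> {}" using dir by (auto simp: J_def directed_by_def)
    show "preorder_on J s"
      unfolding preorder_on_def refl_on_def
      by (auto simp: s_def trans_def trans_on_def intro: order_trans)
    fix u v assume "u \<in> J" "v \<in> J"
    then obtain i j where ij: "i \<in> I" "j \<in> I" "u = f i" "v = f j" by (auto simp: J_def)
    obtain k where "k \<in> I" "(i, k) \<in> r" "(j, k) \<in> r"
      using dir ij unfolding directed_by_def by blast
    then show "\<exists>w\<in>J. (u, w) \<in> s \<and> (v, w) \<in> s"
      using ij mono by (intro bexI[of _ "f k"]) (auto simp: J_def s_def)
  qed
  have "((\<lambda>u. lip_apply u x) \<longlongrightarrow> h x) (net_filter J s)" for x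
  proof (rule tendstoI)
    fix e :: real assume "0 < e"
    then obtain i where i: "i \<in> I" and "\<forall>j\<in>I. (i, j) \<in> r \<longrightarrow> dist (lip_apply (f j) x) (h x) < e"
      using tendstoD[OF lim] unfolding eventually_net_filter[OF dir] by blast
    moreover obtain k where k: "k \<in> I" "(i, k) \<in> r"
      using dir i unfolding directed_by_def by blast
    ultimately have close: "dist (lip_apply (f k) x) (h x) < e" by blast
    show "\<forall>\<^sub>F u in net_filter J s. dist (lip_apply u x) (h x) < e"
      unfolding eventually_net_filter[OF dirJ]
    proof (intro bexI ballI impI)
      show "f k \<in> J" using k by (simp add: J_def)
      fix u assume "u \<in> J" "(f k, u) \<in> s"
      then have "lip_apply (f k) x \<le> lip_apply u x" "lip_apply u x \<le> h x"
        using le_h by (auto simp: J_def s_def)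
      with close show "dist (lip_apply u x) (h x) < e"
        by (simp add: dist_real_def)
    qed
  qed
  moreover have "\<forall>u\<in>J. u \<in> Y" "\<exists>C. \<forall>u\<in>J. norm u \<le> C"
    using fY bdd by (auto simp: J_def)
  moreover have "\<forall>u\<in>J. \<forall>v\<in>J. (u, v) \<in> s \<longrightarrow> (\<forall>x. lip_apply u x \<le> lip_apply v x)"
    by (auto simp: s_def)
  ultimately show ?thesis
    using Y[unfolded lip_order_complete_def, rule_format, of J s "\<lambda>u. u" h] dirJ by blast
qed

text \<open>The functions in \<open>S\<close> vanish at \<open>0\<close>, so a bound on their norms bounds them at every point, and
  the real supremum below is the genuine one.\<close>

definition linear_complete_sublattice :: "'a :: {metric_space, zero} lip0 set \<Rightarrow> bool" where
  "linear_complete_sublattice Y \<longleftrightarrow>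
     subspace Y \<and>
     (\<forall>S. S \<subseteq> Y \<and> S \<noteq> {} \<and> (\<exists>C. \<forall>f\<in>S. norm f \<le> C)
        \<longrightarrow> (\<lambda>x. SUP f\<in>S. lip_apply f x) \<in> lip_apply ` Y)"

end

theory Submission
  imports Defs
begin

text \<open>
  The heart of the matter is that an order complete subalgebra \<open>Y\<close> is a lattice. In terms of the
  quotients \<open>u = f / \<zeta>\<close> the product is pointwise multiplication, so \<open>Y\<close> is stable under polynomials
  without constant term, and for a Lipschitz function \<open>\<phi>\<close> vanishing at \<open>0\<close> the norm of \<open>\<zeta> \<phi>(f / \<zeta>)\<close> is
  controlled by the Lipschitz constant of \<open>\<phi>\<close> (lemma \<open>norm_calc_le\<close>). Such polynomials increase to
  \<open>sqrt (u\<^sup>2 + \<eta>\<^sup>2) - \<eta>\<close> with bounded Lipschitz constants for each \<open>\<eta> > 0\<close>, and these functions increase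
  to \<open>\<bar>u\<bar>\<close> with Lipschitz constant \<open>1\<close>. Order completeness therefore yields \<open>\<bar>f\<bar> \<in> Y\<close> (\<open>abs_mem\<close>), hence
  finite maxima, and hence arbitrary suprema of bounded sets as increasing limits of finite ones
  (\<open>SUP_mem\<close>). This is (i).

  A complete lattice contains the lower limit of every bounded net in it. The bounded parts of \<open>Y\<close>
  are thus closed under pointwise convergence (\<open>closed_pointwise_bounded\<close>), and the Krein--Smulian
  theorem (\<open>krein_smulian_lip0\<close>) makes \<open>Y\<close> weak-star closed. To prove that theorem, the functional that
  separates \<open>f\<close> from \<open>Y\<close> on \<open>Y + \<real> f\<close> is written as a norm convergent series of combinations of
  evaluations; a single approximation step combines compactness of the unit ball with the
  Hahn--Banach theorem. Conversely, a bounded pointwise convergent net converges weak-star, so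
  every weak-star closed set is order complete.

  For (ii), write \<open>f \<or> (g - c \<zeta>) = f + max 0 ((g - f) - c \<zeta>)\<close>. The function \<open>max 0 (v - c \<zeta>)\<close> is an
  infimum of positive parts of quadratic polynomials in \<open>v\<close> without constant term
  (\<open>truncation_mem\<close>), so it belongs to the complete lattice \<open>Y\<close>.\<close>

section \<open>Extension of linear functionals\<close>

text \<open>The Hahn--Banach theorem for a linear functional that is given by its graph \<open>\<Gamma>\<close>. A maximal
  subspace \<open>M \<supseteq> \<Gamma>\<close> of \<open>\<real> \<times> V\<close> on which \<open>t \<le> p v\<close> is the graph of a total function: for a vector
  \<open>v0\<close>, subadditivity of \<open>p\<close> leaves room for a value \<open>a\<close> between all the lower bounds
  \<open>s - p (u - v0)\<close> and all the upper bounds \<open>p (w + v0) - t\<close>. The graph is single-valued: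
  \<open>p 0 \<le> 0\<close> forces \<open>t = 0\<close> whenever \<open>(t, 0)\<close>, and with it \<open>(- t, 0)\<close>, is in \<open>M\<close>.\<close>

lemma hahn_banach_graph:
  fixes p :: "'v :: real_vector \<Rightarrow> real" and \<Gamma> :: "(real \<times> 'v) set"
  assumes sub: "subspace \<Gamma>" and dom: "\<And>t v. (t, v) \<in> \<Gamma> \<Longrightarrow> t \<le> p v"
    and p_add: "\<And>u v. p (u + v) \<le> p u + p v"
    and p_scale: "\<And>c v. 0 \<le> c \<Longrightarrow> p (c *\<^sub>R v) \<le> c * p v"
  obtains \<psi> where "linear \<psi>" "\<And>v. \<psi> v \<le> p v" "\<And>t v. (t, v) \<in> \<Gamma> \<Longrightarrow> \<psi> v = t"
proof -
  define A where "A = {\<Delta>. subspace \<Delta> \<and> \<Gamma> \<subseteq> \<Delta> \<and> (\<forall>(t, v)\<in>\<Delta>. t \<le> p v)}"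
  have "\<exists>M\<in>A. \<forall>X\<in>A. M \<subseteq> X \<longrightarrow> X = M"
  proof (rule subset_Zorn_nonempty)
    show "A \<noteq> {}" using sub dom unfolding A_def by blast
    fix C assume C: "C \<noteq> {}" "subset.chain A C"
    have CA: "C \<subseteq> A" and tot: "\<And>X Y. X \<in> C \<Longrightarrow> Y \<in> C \<Longrightarrow> X \<subseteq> Y \<or> Y \<subseteq> X"
      using C(2) unfolding subset.chain_def by auto
    have "subspace (\<Union>C)"
      unfolding subspace_def
    proof (intro conjI allI ballI)
      obtain X where "X \<in> C" using C(1) by blast
      moreover from this have "0 \<in> X" using CA unfolding A_def by (auto intro: subspace_0)
      ultimately show "0 \<in> \<Union>C" by blast
      fix x assume x: "x \<in> \<Union>C"
      show "c *\<^sub>R x \<in> \<Union>C" for c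
        using x CA unfolding A_def by (auto intro: subspace_scale)
      fix y assume y: "y \<in> \<Union>C"
      obtain X Y where "X \<in> C" "Y \<in> C" "x \<in> X" "y \<in> Y" using x y by blast
      then obtain Z where "Z \<in> C" "x \<in> Z" "y \<in> Z" using tot by blast
      then show "x + y \<in> \<Union>C"
        using CA unfolding A_def by (auto intro: subspace_add)
    qed
    then show "\<Union>C \<in> A"
      using C(1) CA unfolding A_def by blast
  qed
  then obtain M where "M \<in> A" and max: "\<And>X. X \<in> A \<Longrightarrow> M \<subseteq> X \<Longrightarrow> X = M" by blast
  then have M: "subspace M" "\<Gamma> \<subseteq> M" and Mp: "\<And>t v. (t, v) \<in> M \<Longrightarrow> t \<le> p v"
    unfolding A_def by auto
  have total: "\<exists>a. (a, v0) \<in> M" for v0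
  proof -
    have gap: "s - p (u - v0) \<le> p (w + v0) - t" if "(s, u) \<in> M" "(t, w) \<in> M" for s u t w
      using Mp[of "s + t" "u + w"] subspace_add[OF M(1) that] p_add[of "u - v0" "w + v0"] by simp
    have M0: "(0, 0) \<in> M" using subspace_0[OF M(1)] by (simp add: zero_prod_def)
    define a where "a = (SUP (s, u)\<in>M. s - p (u - v0))"
    have lower: "s - p (u - v0) \<le> a" if "(s, u) \<in> M" for s u
      unfolding a_def using that gap[OF _ M0] by (intro cSUP_upper2[where x = "(s, u)"] bdd_aboveI2) auto
    have upper: "a \<le> p (w + v0) - t" if "(t, w) \<in> M" for t w
      unfolding a_def using that gap M0 by (intro cSUP_least) auto
    \<comment> \<open>Rescaling reduces domination on the larger space to the coefficients \<open>1\<close> and \<open>- 1\<close> of \<open>v0\<close>, where it is \<open>upper\<close> and \<open>lower\<close>.\<close>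
    define \<Delta> where "\<Delta> = span (insert (a, v0) M)"
    have "t \<le> p w" if tw: "(t, w) \<in> \<Delta>" for t w
    proof -
      obtain k where "(t, w) - k *\<^sub>R (a, v0) \<in> M"
        using tw unfolding \<Delta>_def span_insert span_eq_iff[THEN iffD2, OF M(1)] by auto
      then have k: "(t - k * a, w - k *\<^sub>R v0) \<in> M" by simp
      consider "k = 0" | "k > 0" | "k < 0" by linarith
      then show ?thesis
      proof cases
        case 1
        with k show ?thesis using Mp by simp
      next
        case 2
        have "(t / k - a, w /\<^sub>R k - v0) \<in> M"
          using subspace_scale[OF M(1) k, of "inverse k"] 2
          by (simp add: scaleR_diff_right right_diff_distrib field_simps)
        from upper[OF this] have "t / k \<le> p (w /\<^sub>R k)" by simp
        also have "\<dots> \<le> inverse k * p w" using 2 by (intro p_scale) auto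
        finally show ?thesis using 2 by (simp add: field_simps)
      next
        case 3
        have "(t / (- k) + a, w /\<^sub>R (- k) + v0) \<in> M"
          using subspace_scale[OF M(1) k, of "inverse (- k)"] 3
          by (simp add: scaleR_diff_right right_diff_distrib field_simps)
        from lower[OF this] have "t / (- k) \<le> p (w /\<^sub>R (- k))" by simp
        also have "\<dots> \<le> inverse (- k) * p w" using 3 by (intro p_scale) auto
        finally show ?thesis using 3 by (simp add: field_simps)
      qed
    qed
    then have "\<Delta> \<in> A"
      using M(2) span_superset[of "insert (a, v0) M"] unfolding A_def \<Delta>_def by auto
    then have "\<Delta> = M"
      using span_superset[of "insert (a, v0) M"] by (intro max) (auto simp: \<Delta>_def)
    then show ?thesis
      using span_superset[of "insert (a, v0) M"] unfolding \<Delta>_def by blast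
  qed
  have unique: "s = t" if "(s, v) \<in> M" "(t, v) \<in> M" for s t v
  proof -
    have p0: "p 0 \<le> 0" using p_scale[of 0 0] by simp
    have "(s - t, 0) \<in> M" "(t - s, 0) \<in> M"
      using subspace_diff[OF M(1) that] subspace_diff[OF M(1) that(2) that(1)] by auto
    from this[THEN Mp] p0 show ?thesis by simp
  qed
  obtain \<psi> where \<psi>: "\<And>v. (\<psi> v, v) \<in> M" using total by metis
  have "\<psi> (u + v) = \<psi> u + \<psi> v" for u v
    using unique[OF \<psi>[of "u + v"]] subspace_add[OF M(1) \<psi> \<psi>, of u v] by simp
  moreover have "\<psi> (c *\<^sub>R v) = c *\<^sub>R \<psi> v" for c v
    using unique[OF \<psi>[of "c *\<^sub>R v"]] subspace_scale[OF M(1) \<psi>, of c v] by simp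
  ultimately have "linear \<psi>" by (simp add: linear_iff)
  then show ?thesis
    using that[of \<psi>] Mp[OF \<psi>] M(2) unique[OF \<psi>] by blast
qed

text \<open>Induction on the set: if \<open>a\<close> does not vanish at some \<open>v\<close> in the common kernel of the others, then
  subtracting a multiple of \<open>a\<close> from \<open>\<psi>\<close> makes it vanish at \<open>v\<close>, and every vector of that kernel differs
  from one in the kernel of \<open>a\<close> by a multiple of \<open>v\<close>; otherwise \<open>a\<close> may be dropped.\<close>

lemma in_span_if_vanishes_on_common_kernel:
  fixes A :: "('b :: real_normed_vector \<Rightarrow>\<^sub>L real) set"
  assumes "finite A" and "\<And>h. (\<And>a. a \<in> A \<Longrightarrow> blinfun_apply a h = 0) \<Longrightarrow> blinfun_apply \<psi> h = 0"
  shows "\<psi> \<in> span A"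
  using assms
proof (induction A arbitrary: \<psi> rule: finite_induct)
  case empty
  then have "\<psi> = 0" by (intro blinfun_eqI) auto
  then show ?case by simp
next
  case (insert a A)
  show ?case
  proof (cases "\<exists>v. (\<forall>b\<in>A. blinfun_apply b v = 0) \<and> blinfun_apply a v \<noteq> 0")
    case True
    then obtain v where v: "\<And>b. b \<in> A \<Longrightarrow> blinfun_apply b v = 0" "blinfun_apply a v \<noteq> 0" by blast
    define c where "c = blinfun_apply \<psi> v / blinfun_apply a v"
    have "\<psi> - c *\<^sub>R a \<in> span A"
    proof (rule insert.IH)
      fix h assume h: "\<And>b. b \<in> A \<Longrightarrow> blinfun_apply b h = 0"
      define r where "r = blinfun_apply a h / blinfun_apply a v"
      have "blinfun_apply \<psi> (h - r *\<^sub>R v) = 0"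
      proof (rule insert.prems)
        fix b assume "b \<in> insert a A"
        then show "blinfun_apply b (h - r *\<^sub>R v) = 0"
          using h v by (auto simp: blinfun.diff_right blinfun.scaleR_right r_def)
      qed
      then show "blinfun_apply (\<psi> - c *\<^sub>R a) h = 0"
        by (simp add: blinfun.diff_right blinfun.scaleR_right blinfun.diff_left blinfun.scaleR_left
            c_def r_def)
    qed
    then have "\<psi> - c *\<^sub>R a \<in> span (insert a A)"
      using span_mono[of A "insert a A"] by blast
    moreover have "c *\<^sub>R a \<in> span (insert a A)"
      by (intro span_scale span_base) simp
    ultimately show ?thesis
      using span_add by fastforce
  next
    case False
    then have "\<psi> \<in> span A"
      using insert.prems by (intro insert.IH) blast
    then show ?thesis
      using span_mono[of A "insert a A"] by blast
  qed
qed


section \<open>The Krein--Smulian theorem for the weak-star topology\<close>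

lemma lip_eval_apply [simp]: "blinfun_apply (lip_eval x) f = lip_apply f x"
  by transfer simp

lemma continuous_on_snd_apply:
  "continuous_on S (\<lambda>p :: 'c :: topological_space \<times> ('a \<Rightarrow> 'b :: topological_space). snd p x)"
  by (rule continuous_on_compose2[OF continuous_on_product_coordinates])
    (auto intro: continuous_on_snd continuous_on_id)

text \<open>The Lipschitz constant seen by the pairs in \<open>Q\<close>. It depends on finitely many values of \<open>h\<close>, and the
  norm of \<open>lip0\<close> is its supremum over the finite sets \<open>Q\<close>. A pair \<open>(x, x)\<close> contributes \<open>0\<close>.\<close>

definition pair_seminorm :: "('a \<times> 'a) set \<Rightarrow> 'a :: {metric_space, zero} lip0 \<Rightarrow> real" where
  "pair_seminorm Q h = Max ((\<lambda>(x, y). \<bar>lip_apply h x - lip_apply h y\<bar> / dist x y) ` Q)"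

context
  fixes Q :: "('a :: {metric_space, zero} \<times> 'a) set"
  assumes Q: "finite Q" "Q \<noteq> {}"
begin

lemma pair_seminorm_ge:
  "(x, y) \<in> Q \<Longrightarrow> \<bar>lip_apply h x - lip_apply h y\<bar> / dist x y \<le> pair_seminorm Q h"
  unfolding pair_seminorm_def using Q by (intro Max_ge) (auto intro: rev_image_eqI)

lemma pair_seminorm_leI:
  "(\<And>x y. (x, y) \<in> Q \<Longrightarrow> \<bar>lip_apply h x - lip_apply h y\<bar> / dist x y \<le> b) \<Longrightarrow> pair_seminorm Q h \<le> b"
  unfolding pair_seminorm_def using Q by (subst Max_le_iff) auto

lemma pair_seminorm_nonneg: "0 \<le> pair_seminorm Q h"
proof -
  obtain x y where "(x, y) \<in> Q" using Q by auto
  from pair_seminorm_ge[OF this, of h] show ?thesis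
    by (meson abs_ge_zero divide_nonneg_nonneg order_trans zero_le_dist)
qed

lemma pair_seminorm_le_norm: "pair_seminorm Q h \<le> norm h"
proof (rule pair_seminorm_leI)
  fix x y :: 'a
  show "\<bar>lip_apply h x - lip_apply h y\<bar> / dist x y \<le> norm h"
    using lip0_diff_le[of h x y] by (cases "x = y") (auto simp: divide_le_eq)
qed

lemma pair_seminorm_add: "pair_seminorm Q (h + k) \<le> pair_seminorm Q h + pair_seminorm Q k"
proof (rule pair_seminorm_leI)
  fix x y assume xy: "(x, y) \<in> Q"
  have "\<bar>lip_apply (h + k) x - lip_apply (h + k) y\<bar> / dist x y
      \<le> (\<bar>lip_apply h x - lip_apply h y\<bar> + \<bar>lip_apply k x - lip_apply k y\<bar>) / dist x y"
    by (intro divide_right_mono) auto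
  with pair_seminorm_ge[OF xy, of h] pair_seminorm_ge[OF xy, of k]
  show "\<bar>lip_apply (h + k) x - lip_apply (h + k) y\<bar> / dist x y
      \<le> pair_seminorm Q h + pair_seminorm Q k"
    by (simp add: add_divide_distrib)
qed

lemma pair_seminorm_scale: "pair_seminorm Q (c *\<^sub>R h) \<le> \<bar>c\<bar> * pair_seminorm Q h"
proof (rule pair_seminorm_leI)
  fix x y assume xy: "(x, y) \<in> Q"
  have "\<bar>lip_apply (c *\<^sub>R h) x - lip_apply (c *\<^sub>R h) y\<bar> / dist x y
      = \<bar>c\<bar> * (\<bar>lip_apply h x - lip_apply h y\<bar> / dist x y)"
    by (simp add: abs_mult flip: right_diff_distrib)
  also have "\<dots> \<le> \<bar>c\<bar> * pair_seminorm Q h"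
    using pair_seminorm_ge[OF xy] by (intro mult_left_mono) auto
  finally show "\<bar>lip_apply (c *\<^sub>R h) x - lip_apply (c *\<^sub>R h) y\<bar> / dist x y
      \<le> \<bar>c\<bar> * pair_seminorm Q h" .
qed

end

text \<open>This is where compactness enters. Suppose that every finite set of pairs fails to
  dominate. After rescaling to norm one, the failures have the finite intersection property inside
  the compact graph, so some \<open>(t, g)\<close> fails for all pairs at once, that is, \<open>N * norm g \<le> t - e\<close>. This
  contradicts \<open>t \<le> N * norm g\<close>. The constant in front of the seminorm is the norm bound \<open>N\<close> itself; it
  becomes the norm of the approximating functional.\<close>

lemma compact_graph_dominated_by_pair_seminorm:
  fixes \<Gamma> :: "(real \<times> 'a :: {metric_space, zero} lip0) set"
  assumes sub: "subspace \<Gamma>" and bnd: "\<And>t g. (t, g) \<in> \<Gamma> \<Longrightarrow> \<bar>t\<bar> \<le> N * norm g"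
    and cpt: "compact {(t, lip_apply g) |t g. (t, g) \<in> \<Gamma> \<and> norm g \<le> 1}"
    and N: "0 \<le> N" and e: "0 < e"
  obtains Q where "finite Q" "Q \<noteq> {}"
    "\<And>t g. (t, g) \<in> \<Gamma> \<Longrightarrow> t \<le> e * norm g + N * pair_seminorm Q g"
proof -
  define G where "G = {(t, lip_apply g) |t g. (t, g) \<in> \<Gamma> \<and> norm g \<le> 1}"
  define D where "D = (\<lambda>(x :: 'a, y). {p :: real \<times> ('a \<Rightarrow> real).
      e \<le> fst p \<and> N * \<bar>snd p x - snd p y\<bar> \<le> (fst p - e) * dist x y})"
  have closed: "closed (D i)" for i
    unfolding D_def case_prod_beta
    by (intro closed_Collect_conj closed_Collect_le continuous_intros continuous_on_snd_apply)
  have "\<exists>P. finite P \<and> G \<inter> (\<Inter>i\<in>P. D i) = {}"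
  proof (rule ccontr)
    assume none: "\<not> ?thesis"
    have "G \<inter> (\<Inter>i\<in>UNIV. D i) \<noteq> {}"
    proof (rule compact_imp_fip_image)
      show "compact G" unfolding G_def by (rule cpt)
    qed (use closed none in blast)+
    then obtain p where p: "p \<in> G" "\<And>i. p \<in> D i" by blast
    then obtain t g where tg: "(t, g) \<in> \<Gamma>" "norm g \<le> 1" and "p = (t, lip_apply g)"
      by (auto simp: G_def)
    with p(2) have et: "e \<le> t"
      and d: "\<And>x y. N * \<bar>lip_apply g x - lip_apply g y\<bar> \<le> (t - e) * dist x y"
      by (auto simp: D_def)
    have "N * norm g \<le> t - e"
    proof (cases "N = 0")
      case False
      with N have "N > 0" by simp
      moreover have "norm g \<le> (t - e) / N"
        using d et \<open>N > 0\<close> by (intro norm_lip0_leI) (auto simp: field_simps)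
      ultimately show ?thesis by (simp add: field_simps)
    qed (use et in simp)
    with bnd[OF tg(1)] e show False by simp
  qed
  then obtain P where P: "finite P" "G \<inter> (\<Inter>i\<in>P. D i) = {}" by blast
  \<comment> \<open>The pair \<open>(0, 0)\<close> contributes \<open>0\<close> and keeps the maximum in \<open>pair_seminorm\<close> over a nonempty set.\<close>
  define Q where "Q = insert (0, 0) P"
  have Q: "finite Q" "Q \<noteq> {}" using P by (auto simp: Q_def)
  have unit: "t \<le> e + N * pair_seminorm Q g" if g: "(t, g) \<in> \<Gamma>" "norm g = 1" for t g
  proof (cases "t < e")
    case True
    then show ?thesis
      using N pair_seminorm_nonneg[OF Q, of g] by (smt (verit) mult_nonneg_nonneg)
  next
    case False
    have "(t, lip_apply g) \<in> G" using g by (auto simp: G_def)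
    then obtain x y where xy: "(x, y) \<in> P"
      and gt: "(t - e) * dist x y < N * \<bar>lip_apply g x - lip_apply g y\<bar>"
      using P(2) False by (fastforce simp: D_def)
    then have "dist x y > 0" by auto
    with gt have "t - e \<le> N * (\<bar>lip_apply g x - lip_apply g y\<bar> / dist x y)"
      by (simp add: field_simps)
    also have "\<dots> \<le> N * pair_seminorm Q g"
      using xy N by (intro mult_left_mono pair_seminorm_ge[OF Q]) (auto simp: Q_def)
    finally show ?thesis by simp
  qed
  have "t \<le> e * norm g + N * pair_seminorm Q g" if g: "(t, g) \<in> \<Gamma>" for t g
  proof (cases "g = 0")
    case True
    then show ?thesis
      using bnd[OF g] N pair_seminorm_nonneg[OF Q, of g] by simp
  next
    case False
    define r where "r = norm g"
    have r: "r > 0" using False by (simp add: r_def)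
    have "(t / r, g /\<^sub>R r) \<in> \<Gamma>"
      using subspace_scale[OF sub g, of "inverse r"] by (simp add: field_simps)
    then have "t / r \<le> e + N * pair_seminorm Q (g /\<^sub>R r)"
      using r by (intro unit) (auto simp: r_def)
    also have "\<dots> \<le> e + N * (inverse r * pair_seminorm Q g)"
      using pair_seminorm_scale[OF Q, of "inverse r" g] r N
      by (intro add_left_mono mult_left_mono) auto
    finally show ?thesis using r by (simp add: field_simps flip: r_def)
  qed
  with that Q show ?thesis by blast
qed

text \<open>Extending \<open>(g, g) \<mapsto> t\<close> from the diagonal to \<open>lip0 \<times> lip0\<close>, dominated by
  \<open>e * norm g + N * pair_seminorm Q h\<close>, splits the functional into a part of norm at most \<open>e\<close> and a
  part bounded by the seminorm. The latter lives on all of \<open>lip0\<close> with norm at most \<open>N\<close>, and it only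
  depends on finitely many values, so it is a combination of evaluations.\<close>

lemma finitely_supported_approximation:
  fixes \<Gamma> :: "(real \<times> 'a :: {metric_space, zero} lip0) set"
  assumes sub: "subspace \<Gamma>" and bnd: "\<And>t g. (t, g) \<in> \<Gamma> \<Longrightarrow> \<bar>t\<bar> \<le> N * norm g"
    and cpt: "compact {(t, lip_apply g) |t g. (t, g) \<in> \<Gamma> \<and> norm g \<le> 1}"
    and N: "0 \<le> N" and e: "0 < e"
  obtains \<mu> where "\<mu> \<in> span (range lip_eval)" "norm \<mu> \<le> N"
    "\<And>t g. (t, g) \<in> \<Gamma> \<Longrightarrow> \<bar>t - blinfun_apply \<mu> g\<bar> \<le> e * norm g"
proof -
  obtain Q where Q: "finite Q" "Q \<noteq> {}"
    and dom: "\<And>t g. (t, g) \<in> \<Gamma> \<Longrightarrow> t \<le> e * norm g + N * pair_seminorm Q g"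
    using compact_graph_dominated_by_pair_seminorm[OF assms] by metis
  define p where "p = (\<lambda>(g :: 'a lip0, h). e * norm g + N * pair_seminorm Q h)"
  define \<Delta> where "\<Delta> = (\<lambda>(t, g). (t, (g, g))) ` \<Gamma>"
  have "linear (\<lambda>(t :: real, g :: 'a lip0). (t, (g, g)))"
    by (auto simp: linear_iff)
  then have "subspace \<Delta>"
    unfolding \<Delta>_def using sub by (rule linear_subspace_image)
  moreover have "t \<le> p v" if "(t, v) \<in> \<Delta>" for t v
    using that dom by (auto simp: \<Delta>_def p_def)
  moreover have "p (u + v) \<le> p u + p v" for u v
  proof -
    have "e * norm (fst u + fst v) \<le> e * norm (fst u) + e * norm (fst v)"
      using e norm_triangle_ineq[of "fst u" "fst v"] by (simp flip: distrib_left)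
    moreover have "N * pair_seminorm Q (snd u + snd v)
        \<le> N * pair_seminorm Q (snd u) + N * pair_seminorm Q (snd v)"
      using mult_left_mono[OF pair_seminorm_add[OF Q] N, of "snd u" "snd v"]
      by (simp add: distrib_left)
    ultimately show ?thesis by (simp add: p_def case_prod_beta)
  qed
  moreover have "p (c *\<^sub>R v) \<le> c * p v" if "0 \<le> c" for c v
    using that mult_left_mono[OF pair_seminorm_scale[OF Q] N, of c "snd v"]
    by (simp add: p_def case_prod_beta algebra_simps)
  ultimately obtain \<psi> where lin: "linear \<psi>" and le: "\<And>v. \<psi> v \<le> p v"
    and ext: "\<And>t v. (t, v) \<in> \<Delta> \<Longrightarrow> \<psi> v = t"
    using hahn_banach_graph[of \<Delta> p] by metis
  have q0: "pair_seminorm Q 0 = 0"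
    using pair_seminorm_le_norm[OF Q, of 0] pair_seminorm_nonneg[OF Q, of 0] by simp
  have q_minus: "pair_seminorm Q (- h) \<le> pair_seminorm Q h" for h
    using pair_seminorm_scale[OF Q, of "- 1" h] by simp
  have \<psi>_snd: "\<bar>\<psi> (0, h)\<bar> \<le> N * pair_seminorm Q h" for h
  proof -
    have "- \<psi> (0, h) = \<psi> (0, - h)" using linear_neg[OF lin, of "(0, h)"] by simp
    with le[of "(0, h)"] le[of "(0, - h)"] mult_left_mono[OF q_minus[of h] N]
    show ?thesis by (simp add: p_def)
  qed
  have bl: "bounded_linear (\<lambda>h. \<psi> (0, h))"
  proof (rule bounded_linear_intro[where K = N])
    show "\<psi> (0, x + y) = \<psi> (0, x) + \<psi> (0, y)" for x y
      using linear_add[OF lin, of "(0, x)" "(0, y)"] by simp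
    show "\<psi> (0, c *\<^sub>R x) = c *\<^sub>R \<psi> (0, x)" for c x
      using linear_scale[OF lin, of c "(0, x)"] by simp
    show "norm (\<psi> (0, x)) \<le> norm x * N" for x
      using \<psi>_snd[of x] mult_left_mono[OF pair_seminorm_le_norm[OF Q, of x] N]
      by (simp add: mult.commute)
  qed
  define \<mu> where "\<mu> = Blinfun (\<lambda>h. \<psi> (0, h))"
  have \<mu>: "blinfun_apply \<mu> h = \<psi> (0, h)" for h
    unfolding \<mu>_def using bounded_linear_Blinfun_apply[OF bl] by metis
  show ?thesis
  proof
    have "\<mu> \<in> span (lip_eval ` (fst ` Q \<union> snd ` Q))"
    proof (rule in_span_if_vanishes_on_common_kernel)
      show "finite (lip_eval ` (fst ` Q \<union> snd ` Q))" using Q by simp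
      fix h :: "'a lip0"
      assume "\<And>a. a \<in> lip_eval ` (fst ` Q \<union> snd ` Q) \<Longrightarrow> blinfun_apply a h = 0"
      then have "lip_apply h x = 0" if "x \<in> fst ` Q \<union> snd ` Q" for x
        using that by (metis image_eqI lip_eval_apply)
      then have "lip_apply h x = 0 \<and> lip_apply h y = 0" if "(x, y) \<in> Q" for x y
        using that by force
      then have "pair_seminorm Q h \<le> 0"
        by (intro pair_seminorm_leI[OF Q]) auto
      then have "N * pair_seminorm Q h \<le> 0" using N by (simp add: mult_nonneg_nonpos)
      with \<psi>_snd[of h] show "blinfun_apply \<mu> h = 0" by (simp add: \<mu>)
    qed
    then show "\<mu> \<in> span (range lip_eval)"
      using span_mono[of "lip_eval ` (fst ` Q \<union> snd ` Q)" "range lip_eval"] by auto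
    show "norm \<mu> \<le> N"
    proof (rule norm_blinfun_bound[OF N])
      show "norm (blinfun_apply \<mu> h) \<le> N * norm h" for h
        using \<psi>_snd[of h] mult_left_mono[OF pair_seminorm_le_norm[OF Q, of h] N] by (simp add: \<mu>)
    qed
    fix t g assume "(t, g) \<in> \<Gamma>"
    then have "\<psi> (g, g) = t" by (intro ext) (auto simp: \<Delta>_def)
    then have eq: "t - blinfun_apply \<mu> g = \<psi> (g, 0)"
      using linear_diff[OF lin, of "(g, g)" "(0, g)"] by (simp add: \<mu>)
    have "- \<psi> (g, 0) = \<psi> (- g, 0)" using linear_neg[OF lin, of "(g, 0)"] by simp
    with le[of "(g, 0)"] le[of "(- g, 0)"]
    show "\<bar>t - blinfun_apply \<mu> g\<bar> \<le> e * norm g"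
      by (simp add: eq p_def q0)
  qed
qed

text \<open>Evaluations are coordinate projections, so subtracting one acts continuously on the graph.\<close>

lemma compact_graph_shift:
  fixes \<Gamma> :: "(real \<times> 'a :: {metric_space, zero} lip0) set"
  assumes "\<mu> \<in> span (range lip_eval)"
    and "compact {(t, lip_apply g) |t g. (t, g) \<in> \<Gamma> \<and> norm g \<le> 1}"
  shows "compact {(t - blinfun_apply \<mu> g, lip_apply g) |t g. (t, g) \<in> \<Gamma> \<and> norm g \<le> 1}"
  using assms(1)
proof (induction \<mu> rule: span_induct_alt)
  case base
  with assms(2) show ?case by simp
next
  case (step c \<delta> \<mu>)
  then obtain x where x: "\<delta> = lip_eval x" by blast
  have "{(t - blinfun_apply (c *\<^sub>R \<delta> + \<mu>) g, lip_apply g) |t g. (t, g) \<in> \<Gamma> \<and> norm g \<le> 1}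
      = (\<lambda>p. (fst p - c * snd p x, snd p)) `
        {(t - blinfun_apply \<mu> g, lip_apply g) |t g. (t, g) \<in> \<Gamma> \<and> norm g \<le> 1}"
    unfolding x
    by (force simp: blinfun.add_left blinfun.scaleR_left image_iff algebra_simps)
  then show ?case
    using step by (auto intro!: compact_continuous_image continuous_intros continuous_on_snd_apply)
qed

text \<open>A functional on a subspace that is pointwise continuous on the unit ball (in the form of a compact
  graph) comes from the predual. Approximate it by a combination of evaluations up to half of its
  norm and repeat with the error: the corrections decrease geometrically, so their sum converges
  in norm, and the errors tend to zero.\<close>

lemma represented_by_lip_free:
  fixes \<Gamma> :: "(real \<times> 'a :: {metric_space, zero} lip0) set"
  assumes sub: "subspace \<Gamma>" and bnd: "\<And>t g. (t, g) \<in> \<Gamma> \<Longrightarrow> \<bar>t\<bar> \<le> N * norm g"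
    and cpt: "compact {(t, lip_apply g) |t g. (t, g) \<in> \<Gamma> \<and> norm g \<le> 1}"
    and N: "0 < N"
  obtains \<mu> where "\<mu> \<in> lip_free" "\<And>t g. (t, g) \<in> \<Gamma> \<Longrightarrow> blinfun_apply \<mu> g = t"
proof -
  define P where "P = (\<lambda>n \<nu>. \<nu> \<in> span (range lip_eval) \<and>
    (\<forall>(t, g)\<in>\<Gamma>. \<bar>t - blinfun_apply \<nu> g\<bar> \<le> N * (1 / 2) ^ n * norm g))"
  have "\<exists>\<nu>. \<forall>n. P n (\<nu> n) \<and> norm (\<nu> (Suc n) - \<nu> n) \<le> N * (1 / 2) ^ n"
  proof (rule dependent_nat_choice)
    show "\<exists>\<nu>. P 0 \<nu>"
      using bnd by (intro exI[of _ 0]) (auto simp: P_def span_zero)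
    fix \<nu> n assume \<nu>: "P n \<nu>"
    define \<Delta> where "\<Delta> = (\<lambda>(t, g). (t - blinfun_apply \<nu> g, g)) ` \<Gamma>"
    have lin: "linear (\<lambda>(t, g). (t - blinfun_apply \<nu> g, g))"
      by (auto simp: linear_iff blinfun.add_right blinfun.scaleR_right algebra_simps)
    obtain \<mu> where \<mu>: "\<mu> \<in> span (range lip_eval)" "norm \<mu> \<le> N * (1 / 2) ^ n"
      "\<And>t g. (t, g) \<in> \<Delta> \<Longrightarrow> \<bar>t - blinfun_apply \<mu> g\<bar> \<le> (N * (1 / 2) ^ Suc n) * norm g"
    proof (rule finitely_supported_approximation)
      show "subspace \<Delta>" unfolding \<Delta>_def using lin sub by (rule linear_subspace_image)
      show "\<bar>t\<bar> \<le> N * (1 / 2) ^ n * norm g" if "(t, g) \<in> \<Delta>" for t g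
        using that \<nu> by (auto simp: \<Delta>_def P_def)
      have "{(t, lip_apply g) |t g. (t, g) \<in> \<Delta> \<and> norm g \<le> 1}
          = {(t - blinfun_apply \<nu> g, lip_apply g) |t g. (t, g) \<in> \<Gamma> \<and> norm g \<le> 1}"
        by (force simp: \<Delta>_def)
      then show "compact {(t, lip_apply g) |t g. (t, g) \<in> \<Delta> \<and> norm g \<le> 1}"
        using compact_graph_shift[OF _ cpt] \<nu> by (simp add: P_def)
      show "0 \<le> N * (1 / 2) ^ n" "0 < N * (1 / 2) ^ Suc n" using N by auto
    qed (rule that)
    have "P (Suc n) (\<nu> + \<mu>)"
      unfolding P_def
    proof (intro conjI ballI)
      show "\<nu> + \<mu> \<in> span (range lip_eval)" using \<nu> \<mu>(1) by (auto simp: P_def intro: span_add)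
      fix q assume "q \<in> \<Gamma>"
      then show "case q of (t, g) \<Rightarrow>
          \<bar>t - blinfun_apply (\<nu> + \<mu>) g\<bar> \<le> N * (1 / 2) ^ Suc n * norm g"
        using \<mu>(3)[of "fst q - blinfun_apply \<nu> (snd q)" "snd q"]
        by (force simp: \<Delta>_def blinfun.add_left image_iff algebra_simps case_prod_beta)
    qed
    with \<mu>(2) show "\<exists>\<nu>'. P (Suc n) \<nu>' \<and> norm (\<nu>' - \<nu>) \<le> N * (1 / 2) ^ n"
      by (intro exI[of _ "\<nu> + \<mu>"]) auto
  qed
  then obtain \<nu> where \<nu>: "\<And>n. P n (\<nu> n)" "\<And>n. norm (\<nu> (Suc n) - \<nu> n) \<le> N * (1 / 2) ^ n"
    by blast
  have "summable (\<lambda>n. N * (1 / 2 :: real) ^ n)"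
    by (intro summable_mult summable_geometric) auto
  then have "summable (\<lambda>n. \<nu> (Suc n) - \<nu> n)"
    by (rule summable_comparison_test'[where N = 0]) (rule \<nu>(2))
  then have "convergent (\<lambda>n. \<Sum>k<n. \<nu> (Suc k) - \<nu> k)"
    by (rule summable_iff_convergent[THEN iffD1])
  then have "convergent (\<lambda>n. (\<Sum>k<n. \<nu> (Suc k) - \<nu> k) + \<nu> 0)"
    by (intro convergent_add convergent_const)
  then have "convergent \<nu>"
    by (simp add: sum_lessThan_telescope)
  then obtain \<mu> where \<mu>: "\<nu> \<longlonglongrightarrow> \<mu>" by (auto simp: convergent_def)
  show ?thesis
  proof
    show "\<mu> \<in> lip_free"
      unfolding lip_free_def closure_sequential using \<nu>(1) \<mu> by (auto simp: P_def)
    fix t g assume tg: "(t, g) \<in> \<Gamma>"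
    have "(\<lambda>n. N * (1 / 2) ^ n * norm g) \<longlonglongrightarrow> N * 0 * norm g"
      by (intro tendsto_intros LIMSEQ_power_zero) auto
    then have null: "(\<lambda>n. N * (1 / 2) ^ n * norm g) \<longlonglongrightarrow> 0" by simp
    have "norm (t - blinfun_apply (\<nu> n) g) \<le> N * (1 / 2) ^ n * norm g" for n
      using \<nu>(1)[of n] tg unfolding P_def by fastforce
    then have "(\<lambda>n. t - blinfun_apply (\<nu> n) g) \<longlonglongrightarrow> 0"
      by (intro Lim_null_comparison[OF _ null] always_eventually allI)
    moreover have "(\<lambda>n. t - blinfun_apply (\<nu> n) g) \<longlonglongrightarrow> t - blinfun_apply \<mu> g"
      by (intro tendsto_intros \<mu>)
    ultimately show "blinfun_apply \<mu> g = t"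
      using LIMSEQ_unique by fastforce
  qed
qed

text \<open>Tychonoff's theorem: the ball is a closed subset of a product of compact intervals.\<close>

lemma compact_pointwise_lip_ball:
  "compact (lip_apply ` {g :: 'a :: {metric_space, zero} lip0. norm g \<le> C})"
proof (cases "0 \<le> C")
  case True
  define B where "B = PiE UNIV (\<lambda>x :: 'a. {- C * dist x 0 .. C * dist x 0})"
  have "compactin (product_topology (\<lambda>_ :: 'a. euclidean) UNIV) B"
    unfolding B_def compactin_PiE by auto
  then have "compact B"
    by (simp add: euclidean_product_topology)
  moreover have "closed {h :: 'a \<Rightarrow> real. h 0 = 0 \<and> (\<forall>x y. \<bar>h x - h y\<bar> \<le> C * dist x y)}"
    by (intro closed_Collect_conj closed_Collect_all closed_Collect_le closed_Collect_eq
        continuous_intros continuous_on_product_coordinates)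
  moreover have "lip_apply ` {g :: 'a lip0. norm g \<le> C}
      = B \<inter> {h. h 0 = 0 \<and> (\<forall>x y. \<bar>h x - h y\<bar> \<le> C * dist x y)}"
  proof (intro equalityI subsetI)
    fix h assume "h \<in> lip_apply ` {g :: 'a lip0. norm g \<le> C}"
    then obtain g :: "'a lip0" where g: "h = lip_apply g" "norm g \<le> C" by auto
    have *: "\<bar>lip_apply g x - lip_apply g y\<bar> \<le> C * dist x y" for x y
      using lip0_diff_le[of g x y] mult_right_mono[OF g(2), of "dist x y"] by simp
    show "h \<in> B \<inter> {h. h 0 = 0 \<and> (\<forall>x y. \<bar>h x - h y\<bar> \<le> C * dist x y)}"
      using * *[of _ 0] by (auto simp: g(1) B_def abs_le_iff) (smt (verit))+
  next
    fix h assume h: "h \<in> B \<inter> {h. h 0 = 0 \<and> (\<forall>x y. \<bar>h x - h y\<bar> \<le> C * dist x y)}"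
    then have "C-lipschitz_on UNIV h"
      using True by (intro lipschitz_onI) (auto simp: dist_real_def)
    then have "lip_apply (Abs_lip0 h) = h"
      using h by (intro Abs_lip0_inverse) auto
    moreover from this have "norm (Abs_lip0 h) \<le> C"
      using h True by (intro norm_lip0_leI) auto
    ultimately show "h \<in> lip_apply ` {g :: 'a lip0. norm g \<le> C}" by force
  qed
  ultimately show ?thesis by (simp add: compact_Int_closed)
next
  case False
  then have "{g :: 'a lip0. norm g \<le> C} = {}"
    using norm_ge_zero order_trans by blast
  then show ?thesis by (metis compact_empty image_empty)
qed

text \<open>The Krein--Smulian theorem for subspaces of \<open>Lip\<^sub>0(M)\<close>. For \<open>f \<notin> Y\<close> the functional \<open>y + t f \<mapsto> t\<close> on
  \<open>Y + \<real> f\<close> is bounded because \<open>Y\<close> is norm closed, and its graph over the unit ball is pointwise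
  compact because bounded parts of \<open>Y\<close> are pointwise closed. An element of the predual that represents
  it vanishes on \<open>Y\<close> but not at \<open>f\<close>.\<close>

theorem krein_smulian_lip0:
  fixes Y :: "'a :: {metric_space, zero} lip0 set"
  assumes sub: "subspace Y" and closed: "\<And>C. closed (lip_apply ` {g \<in> Y. norm g \<le> C})"
  shows "closedin lip0_weak_star Y"
proof -
  have sep: "\<exists>\<mu>\<in>lip_free. blinfun_apply \<mu> f \<noteq> 0 \<and> (\<forall>g\<in>Y. blinfun_apply \<mu> g = 0)" if f: "f \<notin> Y" for f
  proof -
    have mem: "g \<in> Y \<and> norm g \<le> C" if "lip_apply g \<in> lip_apply ` {g \<in> Y. norm g \<le> C}" for g C
      using that by (auto simp: lip_apply_inject)
    have "continuous_on UNIV (lip_apply :: 'a lip0 \<Rightarrow> _)"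
    proof (rule continuous_on_coordinatewise_then_product)
      fix x :: 'a
      have "continuous_on UNIV (blinfun_apply (lip_eval x))" by (intro continuous_intros)
      then show "continuous_on UNIV (\<lambda>g :: 'a lip0. lip_apply g x)" by simp
    qed
    then have "Topological_Spaces.closed (lip_apply -` lip_apply ` {g \<in> Y. norm g \<le> norm f + 1})"
      by (rule closed_vimage[OF closed])
    then have "open (- (lip_apply -` lip_apply ` {g \<in> Y. norm g \<le> norm f + 1}))"
      by (simp add: open_Compl)
    moreover have "f \<in> - (lip_apply -` lip_apply ` {g \<in> Y. norm g \<le> norm f + 1})"
      using f mem[of f "norm f + 1"] by blast
    ultimately obtain r where r: "r > 0"
      "ball f r \<subseteq> - (lip_apply -` lip_apply ` {g \<in> Y. norm g \<le> norm f + 1})"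
      by (meson open_contains_ball)
    \<comment> \<open>\<open>d\<close> is a lower bound for the distance of \<open>f\<close> to \<open>Y\<close>; points of \<open>Y\<close> within distance \<open>1\<close> of \<open>f\<close> lie in the closed bounded part above.\<close>
    define d where "d = min r 1"
    have d: "d > 0" using r by (simp add: d_def)
    have dle: "d \<le> norm (f - y)" if y: "y \<in> Y" for y
    proof (rule ccontr)
      assume "\<not> d \<le> norm (f - y)"
      then have "y \<in> ball f r" "norm (f - y) < 1" by (auto simp: d_def dist_norm)
      moreover from this have "norm y \<le> norm f + 1"
        using norm_triangle_ineq4[of f "f - y"] by simp
      ultimately show False using r(2) y by auto
    qed
    define \<Gamma> where "\<Gamma> = {(t, g). g - t *\<^sub>R f \<in> Y}"
    have sub\<Gamma>: "subspace \<Gamma>"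
      unfolding subspace_def
    proof (intro conjI allI ballI)
      show "0 \<in> \<Gamma>" using subspace_0[OF sub] by (simp add: \<Gamma>_def zero_prod_def)
      fix p assume p: "p \<in> \<Gamma>"
      show "c *\<^sub>R p \<in> \<Gamma>" for c
        using subspace_scale[OF sub, of "snd p - fst p *\<^sub>R f" c] p
        by (auto simp: \<Gamma>_def case_prod_beta scaleR_diff_right)
      fix q assume q: "q \<in> \<Gamma>"
      show "p + q \<in> \<Gamma>"
        using subspace_add[OF sub, of "snd p - fst p *\<^sub>R f" "snd q - fst q *\<^sub>R f"] p q
        by (auto simp: \<Gamma>_def case_prod_beta algebra_simps)
    qed
    have bnd: "\<bar>t\<bar> \<le> 1 / d * norm g" if tg: "(t, g) \<in> \<Gamma>" for t g
    proof (cases "t = 0")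
      case False
      have "g /\<^sub>R t - f \<in> Y"
        using subspace_scale[OF sub, of "g - t *\<^sub>R f" "inverse t"] tg False
        by (simp add: \<Gamma>_def scaleR_diff_right)
      then have "- (g /\<^sub>R t - f) \<in> Y" by (rule subspace_neg[OF sub])
      then have "d \<le> norm (g /\<^sub>R t)"
        using dle[of "- (g /\<^sub>R t - f)"] by simp
      then show ?thesis using False d by (simp add: field_simps)
    qed (use d in simp)
    have "{(t, lip_apply g) |t g. (t, g) \<in> \<Gamma> \<and> norm g \<le> 1}
      = ({- (1 / d) .. 1 / d} \<times> lip_apply ` {g :: 'a lip0. norm g \<le> 1}) \<inter>
        (\<lambda>p x. snd p x - fst p * lip_apply f x) -`
          (lip_apply ` {g \<in> Y. norm g \<le> 1 + 1 / d * norm f})" (is "?L = ?K \<inter> ?F -` ?S")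
    proof (intro equalityI subsetI)
      fix p assume "p \<in> ?L"
      then obtain t g where p: "p = (t, lip_apply g)" "(t, g) \<in> \<Gamma>" "norm g \<le> 1" by blast
      have t: "\<bar>t\<bar> \<le> 1 / d"
        using bnd[OF p(2)] p(3) d by (smt (verit) divide_pos_pos mult_left_le)
      have "norm (g - t *\<^sub>R f) \<le> norm g + \<bar>t\<bar> * norm f"
        using norm_triangle_ineq4[of g "t *\<^sub>R f"] by simp
      also have "\<dots> \<le> 1 + 1 / d * norm f"
        using p(3) t by (intro add_mono mult_right_mono) auto
      finally have "g - t *\<^sub>R f \<in> {g \<in> Y. norm g \<le> 1 + 1 / d * norm f}"
        using p(2) by (simp add: \<Gamma>_def)
      moreover have "?F p = lip_apply (g - t *\<^sub>R f)" by (auto simp: p(1))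
      ultimately have "p \<in> ?F -` ?S" by auto
      then show "p \<in> ?K \<inter> ?F -` ?S"
        using t p by (auto simp: abs_le_iff)
    next
      fix p assume p: "p \<in> ?K \<inter> ?F -` ?S"
      then obtain t g where g: "p = (t, lip_apply g)" "norm g \<le> 1" by auto
      have "?F p = lip_apply (g - t *\<^sub>R f)" by (auto simp: g(1))
      then have "lip_apply (g - t *\<^sub>R f) \<in> ?S" using p by simp
      then have "g - t *\<^sub>R f \<in> Y" using mem by blast
      then show "p \<in> ?L" using g by (auto simp: \<Gamma>_def)
    qed
    moreover have "compact (?K \<inter> ?F -` ?S)"
    proof (rule compact_Int_closed)
      show "compact ?K" by (intro compact_Times compact_pointwise_lip_ball) auto
      have "continuous_on UNIV ?F"
        by (intro continuous_on_coordinatewise_then_product continuous_intros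
            continuous_on_snd_apply)
      then show "Topological_Spaces.closed (?F -` ?S)"
        by (rule closed_vimage[OF closed])
    qed
    ultimately have "compact {(t, lip_apply g) |t g. (t, g) \<in> \<Gamma> \<and> norm g \<le> 1}" by simp
    then obtain \<mu> where \<mu>: "\<mu> \<in> lip_free" "\<And>t g. (t, g) \<in> \<Gamma> \<Longrightarrow> blinfun_apply \<mu> g = t"
      using represented_by_lip_free[OF sub\<Gamma> bnd] d by (metis divide_pos_pos zero_less_one)
    have "(1, f) \<in> \<Gamma>" using subspace_0[OF sub] by (simp add: \<Gamma>_def)
    moreover have "(0, g) \<in> \<Gamma>" if "g \<in> Y" for g using that by (simp add: \<Gamma>_def)
    ultimately show ?thesis using \<mu> by (intro bexI[of _ \<mu>]) fastforce+
  qed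
  have "openin lip0_weak_star (- Y)"
  proof (subst openin_subopen, intro ballI)
    fix f assume "f \<in> - Y"
    then obtain \<mu> where \<mu>: "\<mu> \<in> lip_free" "blinfun_apply \<mu> f \<noteq> 0" "\<And>g. g \<in> Y \<Longrightarrow> blinfun_apply \<mu> g = 0"
      using sep by force
    have "openin lip0_weak_star (blinfun_apply \<mu> -` (- {0}))"
      unfolding lip0_weak_star_def openin_topology_generated_by_iff
      using \<mu>(1) by (intro generate_topology_on.Basis) blast
    then show "\<exists>T. openin lip0_weak_star T \<and> f \<in> T \<and> T \<subseteq> - Y"
      using \<mu> by (intro exI[of _ "blinfun_apply \<mu> -` (- {0})"]) auto
  qed
  then show ?thesis
    by (simp add: closedin_def Compl_eq_Diff_UNIV)
qed


section \<open>Weak-star closed sets are order complete\<close>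

text \<open>On bounded sets the weak-star topology is that of pointwise convergence: the functionals along
  which a bounded net converges form a norm closed subspace, and it contains the evaluations.\<close>

lemma eventually_weak_star_nbhd:
  fixes h :: "'a :: {metric_space, zero} lip0"
  assumes bdd: "\<forall>\<^sub>F i in F. norm (f i) \<le> C"
    and lim: "\<And>x. ((\<lambda>i. lip_apply (f i) x) \<longlongrightarrow> lip_apply h x) F"
    and U: "openin lip0_weak_star U" "h \<in> U"
  shows "\<forall>\<^sub>F i in F. f i \<in> U"
proof -
  have span: "((\<lambda>i. blinfun_apply \<nu> (f i)) \<longlongrightarrow> blinfun_apply \<nu> h) F"
    if "\<nu> \<in> span (range lip_eval)" for \<nu>
    using that
    by (induction rule: span_induct_alt)
      (auto simp: blinfun.add_left blinfun.scaleR_left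
        intro!: tendsto_add tendsto_mult tendsto_const lim)
  have lim_free: "((\<lambda>i. blinfun_apply \<mu> (f i)) \<longlongrightarrow> blinfun_apply \<mu> h) F" if \<mu>: "\<mu> \<in> lip_free" for \<mu>
  proof (rule tendstoI)
    fix e :: real assume e: "e > 0"
    define K where "K = \<bar>C\<bar> + norm h + 1"
    have K: "K > 0" by (simp add: K_def add_nonneg_pos)
    obtain \<nu> where \<nu>: "\<nu> \<in> span (range lip_eval)" "norm (\<nu> - \<mu>) < e / (2 * K)"
      using \<mu> e K unfolding lip_free_def closure_approachable
      by (metis dist_norm divide_pos_pos mult_pos_pos zero_less_numeral)
    have "\<forall>\<^sub>F i in F. dist (blinfun_apply \<nu> (f i)) (blinfun_apply \<nu> h) < e / 2"
      using span[OF \<nu>(1)] e by (intro tendstoD) auto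
    with bdd show "\<forall>\<^sub>F i in F. dist (blinfun_apply \<mu> (f i)) (blinfun_apply \<mu> h) < e"
    proof eventually_elim
      case (elim i)
      have "\<bar>blinfun_apply (\<nu> - \<mu>) (f i - h)\<bar> \<le> norm (\<nu> - \<mu>) * norm (f i - h)"
        using norm_blinfun[of "\<nu> - \<mu>" "f i - h"] by simp
      also have "\<dots> \<le> norm (\<nu> - \<mu>) * K"
        using norm_triangle_ineq4[of "f i" h] elim(1) by (intro mult_left_mono) (auto simp: K_def)
      also have "\<dots> < e / 2"
        using \<nu>(2) K by (simp add: field_simps)
      finally show ?case
        using elim(2) unfolding dist_real_def blinfun.diff_left blinfun.diff_right by linarith
    qed
  qed
  have "generate_topology_on {blinfun_apply \<mu> -` U |\<mu> U. \<mu> \<in> lip_free \<and> open U} U"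
    using U(1) by (simp add: lip0_weak_star_def openin_topology_generated_by_iff)
  then show ?thesis
    using U(2)
  proof induction
    case (Basis s)
    then obtain \<mu> V where s: "s = blinfun_apply \<mu> -` V" "\<mu> \<in> lip_free" "open V" by blast
    with Basis topological_tendstoD[OF lim_free[OF s(2)] s(3)] show ?case by simp
  next
    case (UN K)
    then obtain k where "k \<in> K" "h \<in> k" by blast
    with UN.IH[of k] show ?case by (auto elim: eventually_mono)
  qed (auto intro: eventually_conj)
qed

text \<open>The pointwise limit of a bounded net is Lipschitz and is also the weak-star limit.\<close>

lemma weak_star_closed_imp_order_complete:
  fixes Y :: "'a :: {metric_space, zero} lip0 set"
  assumes "closedin lip0_weak_star Y"
  shows "lip_order_complete Y"
  unfolding lip_order_complete_def
proof (intro allI impI, elim conjE exE)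
  fix I :: "'a lip0 set" and r f h C
  assume dir: "directed_by I r" and Y: "\<forall>i\<in>I. f i \<in> Y" and C: "\<forall>i\<in>I. norm (f i) \<le> C"
    and lim: "\<forall>x. ((\<lambda>i. lip_apply (f i) x) \<longlongrightarrow> h x) (net_filter I r)"
  obtain i0 where i0: "i0 \<in> I" using dir by (auto simp: directed_by_def)
  have nontriv: "net_filter I r \<noteq> bot"
    using dir unfolding trivial_limit_def eventually_net_filter[OF dir]
    by (auto simp: directed_by_def)
  have ev: "\<forall>\<^sub>F i in net_filter I r. i \<in> I"
    unfolding eventually_net_filter[OF dir] using i0 by blast
  have C0: "0 \<le> C" using C i0 by (meson norm_ge_zero order_trans)
  have lip: "\<bar>h x - h y\<bar> \<le> C * dist x y" for x y
  proof (rule tendsto_upperbound[OF _ _ nontriv])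
    show "((\<lambda>i. \<bar>lip_apply (f i) x - lip_apply (f i) y\<bar>) \<longlongrightarrow> \<bar>h x - h y\<bar>) (net_filter I r)"
      using lim by (intro tendsto_intros) auto
    show "\<forall>\<^sub>F i in net_filter I r. \<bar>lip_apply (f i) x - lip_apply (f i) y\<bar> \<le> C * dist x y"
      using ev
    proof eventually_elim
      case (elim i)
      then show ?case
        using lip0_diff_le[of "f i" x y] C mult_right_mono[of "norm (f i)" C "dist x y"] by force
    qed
  qed
  have "h 0 = 0"
    using lim[rule_format, of 0] tendsto_const_iff[OF nontriv, of 0 "h 0"] by simp
  moreover have "C-lipschitz_on UNIV h"
    using lip C0 by (intro lipschitz_onI) (auto simp: dist_real_def)
  ultimately have h: "lip_apply (Abs_lip0 h) = h"
    by (intro Abs_lip0_inverse) auto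
  have "Abs_lip0 h \<in> Y"
  proof (rule ccontr)
    assume "Abs_lip0 h \<notin> Y"
    moreover have "openin lip0_weak_star (- Y)"
      using assms by (simp add: closedin_def Compl_eq_Diff_UNIV)
    ultimately have "\<forall>\<^sub>F i in net_filter I r. f i \<in> - Y"
      using C lim by (intro eventually_weak_star_nbhd[where h = "Abs_lip0 h"])
        (auto simp: h intro: eventually_mono[OF ev])
    with ev have "\<forall>\<^sub>F i in net_filter I r. False"
      by eventually_elim (use Y in auto)
    with nontriv show False by simp
  qed
  with h show "h \<in> lip_apply ` Y" by force
qed


section \<open>Functional calculus in terms of the gauge\<close>

locale lip_gauge =
  fixes \<alpha> :: "real \<Rightarrow> real" and L :: real
  assumes pos: "0 < t \<Longrightarrow> 0 < \<alpha> t" and lip: "L-lipschitz_on {0<..} \<alpha>"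
    and fin: "gauge_D \<alpha> < \<infinity>"
begin

definition D :: real where "D = enn2real (gauge_D \<alpha>)"

lemma D_nonneg: "0 \<le> D"
  by (simp add: D_def)

lemma L_nonneg: "0 \<le> L"
  using lip by (rule lipschitz_on_nonneg)

lemma zeta_0 [simp]: "gauge_zeta \<alpha> 0 = 0"
  by (simp add: gauge_zeta_def)

lemma zeta_pos: "x \<noteq> 0 \<Longrightarrow> 0 < gauge_zeta \<alpha> x"
  using pos by (simp add: gauge_zeta_def)

lemma zeta_nonneg: "0 \<le> gauge_zeta \<alpha> x"
  using zeta_pos[of x] by (cases "x = 0") auto

lemma zeta_lipschitz:
  assumes "x \<noteq> 0" "y \<noteq> 0"
  shows "\<bar>gauge_zeta \<alpha> x - gauge_zeta \<alpha> y\<bar> \<le> L * dist x y"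
proof -
  have "\<bar>gauge_zeta \<alpha> x - gauge_zeta \<alpha> y\<bar> \<le> L * \<bar>dist 0 x - dist 0 y\<bar>"
    using lipschitz_onD[OF lip, of "dist 0 x" "dist 0 y"] assms
    by (simp add: gauge_zeta_def dist_real_def)
  also have "\<dots> \<le> L * dist x y"
    using abs_dist_diff_le[of x 0 y] L_nonneg by (intro mult_left_mono) (auto simp: dist_commute)
  finally show ?thesis .
qed

lemma dist_le_zeta: "dist x 0 \<le> D * gauge_zeta \<alpha> x"
proof (cases "x = 0")
  case False
  define t where "t = dist 0 x"
  have t: "0 < t" using False by (simp add: t_def)
  have "ennreal (t / \<alpha> t) \<le> ennreal D"
    using fin t unfolding D_def by (auto simp: gauge_D_def intro: SUP_upper)
  then have "t / \<alpha> t \<le> D" using D_nonneg by simp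
  then show ?thesis
    using pos[OF t] False by (simp add: gauge_zeta_def t_def dist_commute divide_le_eq)
qed simp

lemma ratio_bound: "\<bar>lip_apply f x / gauge_zeta \<alpha> x\<bar> \<le> D * norm f"
proof (cases "x = 0")
  case False
  have "\<bar>lip_apply f x\<bar> \<le> norm f * dist x 0"
    using lip0_diff_le[of f x 0] by simp
  also have "\<dots> \<le> norm f * (D * gauge_zeta \<alpha> x)"
    using dist_le_zeta by (intro mult_left_mono) auto
  finally show ?thesis
    using zeta_pos[OF False] by (simp add: abs_div divide_le_eq mult_ac)
qed (simp add: D_nonneg)

lemma lip_apply_prod:
  "lip_apply (lip_prod \<alpha> f g) x = lip_apply f x * lip_apply g x / gauge_zeta \<alpha> x"
  using lip_apply_lip_prod[OF pos lip fin, of f g x] by simp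

text \<open>Functional calculus: \<open>\<phi>\<close> is applied to the quotient \<open>f / \<zeta>\<close>, in which the product \<open>\<odot>\<^sub>\<alpha>\<close> becomes the
  pointwise one. At the base point the formula gives \<open>0\<close>, since \<open>\<zeta>\<close> vanishes there.\<close>

definition calc :: "(real \<Rightarrow> real) \<Rightarrow> 'a :: {metric_space, zero} lip0 \<Rightarrow> 'a lip0" where
  "calc \<phi> f = Abs_lip0 (\<lambda>x. gauge_zeta \<alpha> x * \<phi> (lip_apply f x / gauge_zeta \<alpha> x))"

text \<open>With \<open>s = f x / \<zeta> x\<close> and \<open>t = f y / \<zeta> y\<close>, the increment is
  \<open>\<zeta> x * (\<phi> s - \<phi> t) + (\<zeta> x - \<zeta> y) * \<phi> t\<close>, and
  \<open>\<zeta> x * (s - t) = (f x - f y) - t * (\<zeta> x - \<zeta> y)\<close> has no small denominators. The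
  resulting norm bound depends on \<open>\<phi>\<close> only through its Lipschitz constant, which makes it usable along
  sequences of polynomials.\<close>

lemma calc:
  fixes f :: "'a :: {metric_space, zero} lip0"
  assumes \<phi>: "P-lipschitz_on {-R..R} \<phi>" "\<phi> 0 = 0" and R: "D * norm f \<le> R"
  shows lip_apply_calc:
      "lip_apply (calc \<phi> f) x = gauge_zeta \<alpha> x * \<phi> (lip_apply f x / gauge_zeta \<alpha> x)"
    and norm_calc_le: "norm (calc \<phi> f) \<le> P * (norm f + 2 * R * L)"
proof -
  define h where "h = (\<lambda>x. gauge_zeta \<alpha> x * \<phi> (lip_apply f x / gauge_zeta \<alpha> x))"
  define C where "C = P * (norm f + 2 * R * L)"
  have P: "0 \<le> P" using \<phi>(1) by (rule lipschitz_on_nonneg)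
  have R0: "0 \<le> R" using R D_nonneg by (meson mult_nonneg_nonneg norm_ge_zero order_trans)
  have C: "0 \<le> C" using P R0 L_nonneg by (simp add: C_def)
  have u: "\<bar>lip_apply f x / gauge_zeta \<alpha> x\<bar> \<le> R" for x
    using ratio_bound[of f x] R by simp
  have \<phi>_le: "\<bar>\<phi> s - \<phi> t\<bar> \<le> P * \<bar>s - t\<bar>" if "\<bar>s\<bar> \<le> R" "\<bar>t\<bar> \<le> R" for s t
    using lipschitz_onD[OF \<phi>(1), of s t] that by (auto simp: dist_real_def abs_le_iff)
  have at0: "\<bar>h x - h 0\<bar> \<le> C * dist x 0" for x
  proof (cases "x = 0")
    case False
    have "\<bar>h x\<bar> \<le> gauge_zeta \<alpha> x * (P * \<bar>lip_apply f x / gauge_zeta \<alpha> x\<bar>)"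
    proof -
      have "\<bar>\<phi> (lip_apply f x / gauge_zeta \<alpha> x)\<bar> \<le> P * \<bar>lip_apply f x / gauge_zeta \<alpha> x\<bar>"
        using \<phi>_le[OF u, of 0 x] \<phi>(2) R0 by (simp only: diff_zero abs_zero)
      from mult_left_mono[OF this zeta_nonneg[of x]] show ?thesis
        using zeta_nonneg[of x] by (simp only: h_def abs_mult abs_of_nonneg)
    qed
    also have "\<dots> = P * \<bar>lip_apply f x\<bar>"
      using zeta_pos[OF False] by (simp add: abs_div)
    also have "\<dots> \<le> P * (norm f * dist x 0)"
      using P lip0_diff_le[of f x 0] by (intro mult_left_mono) auto
    also have "\<dots> \<le> C * dist x 0"
      using P R0 L_nonneg by (simp add: C_def algebra_simps)
    finally show ?thesis by (simp add: h_def)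
  qed simp
  have main: "\<bar>h x - h y\<bar> \<le> C * dist x y" for x y
  \<comment> \<open>\<open>\<zeta>\<close> may jump at the base point, so pairs that contain it are treated on their own.\<close>
  proof (cases "x = 0 \<or> y = 0")
    case True
    then show ?thesis using at0[of x] at0[of y] by (auto simp: dist_commute abs_minus_commute)
  next
    case False
    define a b where "a = gauge_zeta \<alpha> x" and "b = gauge_zeta \<alpha> y"
    define s t where "s = lip_apply f x / a" and "t = lip_apply f y / b"
    have ab: "0 < a" "0 < b" using False zeta_pos by (auto simp: a_def b_def)
    have st: "\<bar>s\<bar> \<le> R" "\<bar>t\<bar> \<le> R" using u by (auto simp: s_def t_def a_def b_def)
    have abd: "\<bar>a - b\<bar> \<le> L * dist x y"
      using zeta_lipschitz[of x y] False by (simp add: a_def b_def)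
    have "a * (s - t) = (lip_apply f x - lip_apply f y) - t * (a - b)"
      using ab by (simp add: s_def t_def field_simps)
    then have "\<bar>a * (s - t)\<bar> \<le> \<bar>lip_apply f x - lip_apply f y\<bar> + \<bar>t\<bar> * \<bar>a - b\<bar>"
      by (metis abs_mult abs_triangle_ineq4)
    also have "\<dots> \<le> norm f * dist x y + R * (L * dist x y)"
      using st abd R0 by (intro add_mono lip0_diff_le mult_mono) auto
    finally have ast: "a * \<bar>s - t\<bar> \<le> norm f * dist x y + R * (L * dist x y)"
      using ab by (simp add: abs_mult)
    have "h x - h y = a * (\<phi> s - \<phi> t) + (a - b) * \<phi> t"
      by (simp add: h_def s_def t_def a_def b_def algebra_simps)
    then have "\<bar>h x - h y\<bar> \<le> a * \<bar>\<phi> s - \<phi> t\<bar> + \<bar>a - b\<bar> * \<bar>\<phi> t\<bar>"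
      using ab by (metis abs_mult abs_of_pos abs_triangle_ineq)
    also have "\<dots> \<le> a * (P * \<bar>s - t\<bar>) + (L * dist x y) * (P * R)"
    proof (intro add_mono mult_left_mono mult_mono)
      show "\<bar>\<phi> s - \<phi> t\<bar> \<le> P * \<bar>s - t\<bar>" by (rule \<phi>_le[OF st])
      have "\<bar>\<phi> t\<bar> \<le> P * \<bar>t\<bar>" using \<phi>_le[of t 0] st \<phi>(2) R0 by simp
      also have "\<dots> \<le> P * R" using st P by (intro mult_left_mono)
      finally show "\<bar>\<phi> t\<bar> \<le> P * R" .
    qed (use ab abd L_nonneg in auto)
    also have "a * (P * \<bar>s - t\<bar>) \<le> P * (norm f * dist x y + R * (L * dist x y))"
      using mult_left_mono[OF ast P] by (simp add: mult_ac)
    finally show ?thesis by (simp add: C_def algebra_simps)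
  qed
  have "C-lipschitz_on UNIV h"
    using main C by (intro lipschitz_onI) (auto simp: dist_real_def)
  then have eq: "lip_apply (calc \<phi> f) = h"
    unfolding calc_def h_def[symmetric] by (intro Abs_lip0_inverse) (auto simp: h_def)
  then show "lip_apply (calc \<phi> f) x = gauge_zeta \<alpha> x * \<phi> (lip_apply f x / gauge_zeta \<alpha> x)"
    by (simp add: h_def)
  show "norm (calc \<phi> f) \<le> P * (norm f + 2 * R * L)"
    using main C unfolding C_def by (intro norm_lip0_leI) (auto simp: eq)
qed

end


section \<open>Polynomials without constant term increasing to the square root\<close>

text \<open>In terms of \<open>p\<^sub>n = sqrt_iter \<eta> n u + \<eta>\<close> this is the iteration \<open>p\<^sub>n\<^sub>+\<^sub>1 = p\<^sub>n + (u\<^sup>2 + \<eta>\<^sup>2 - p\<^sub>n\<^sup>2) / 2\<close>,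
  \<open>p\<^sub>0 = \<eta>\<close>, for the square root of \<open>u\<^sup>2 + \<eta>\<^sup>2\<close>. Starting at \<open>\<eta>\<close> and subtracting it again yields
  polynomials in \<open>u\<close> without constant term, which act on an algebra without unit. The regularisation
  by \<open>\<eta>\<close> serves to keep the Lipschitz constants of the iterates bounded.\<close>

fun sqrt_iter :: "real \<Rightarrow> nat \<Rightarrow> real \<Rightarrow> real" where
  "sqrt_iter \<eta> 0 u = 0"
| "sqrt_iter \<eta> (Suc n) u = (1 - \<eta>) * sqrt_iter \<eta> n u + (u\<^sup>2 - (sqrt_iter \<eta> n u)\<^sup>2) / 2"

lemma sqrt_iter_zero: "sqrt_iter \<eta> n 0 = 0"
  by (induction n) auto

declare sqrt_iter.simps(2) [simp del]

context
  fixes \<eta> :: real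
  assumes \<eta>: "0 < \<eta>" "\<eta> \<le> 1 / 2"
begin

text \<open>The error is multiplied by a factor that lies between \<open>0\<close> and \<open>1 - \<eta>\<close> as long as
  \<open>p\<^sub>n\<close> and the root lie between \<open>\<eta>\<close> and \<open>1\<close>.\<close>

lemma sqrt_iter_step:
  "(sqrt (u\<^sup>2 + \<eta>\<^sup>2) - \<eta>) - sqrt_iter \<eta> (Suc n) u =
   ((sqrt (u\<^sup>2 + \<eta>\<^sup>2) - \<eta>) - sqrt_iter \<eta> n u) * (1 - (sqrt (u\<^sup>2 + \<eta>\<^sup>2) + (sqrt_iter \<eta> n u + \<eta>)) / 2)"
proof -
  define l where "l = sqrt (u\<^sup>2 + \<eta>\<^sup>2)"
  have "u\<^sup>2 = l\<^sup>2 - \<eta>\<^sup>2" by (simp add: l_def)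
  then show ?thesis unfolding l_def[symmetric]
    by (simp add: sqrt_iter.simps(2) field_simps power2_eq_square)
qed

lemma sqrt_bounds:
  assumes "\<bar>u\<bar> \<le> 1 / 2"
  shows "\<eta> \<le> sqrt (u\<^sup>2 + \<eta>\<^sup>2)" "sqrt (u\<^sup>2 + \<eta>\<^sup>2) \<le> 1"
proof -
  show "\<eta> \<le> sqrt (u\<^sup>2 + \<eta>\<^sup>2)" using \<eta> by (intro real_le_rsqrt) auto
  have "u\<^sup>2 \<le> (1 / 2)\<^sup>2" "\<eta>\<^sup>2 \<le> (1 / 2)\<^sup>2"
    using assms \<eta> by (auto simp: abs_le_square_iff[symmetric])
  then show "sqrt (u\<^sup>2 + \<eta>\<^sup>2) \<le> 1" by (simp add: power2_eq_square)
qed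

lemma sqrt_iter_bounds:
  assumes "\<bar>u\<bar> \<le> 1 / 2"
  shows "0 \<le> sqrt_iter \<eta> n u \<and> sqrt_iter \<eta> n u \<le> sqrt (u\<^sup>2 + \<eta>\<^sup>2) - \<eta>
    \<and> sqrt_iter \<eta> n u \<le> sqrt_iter \<eta> (Suc n) u"
proof (induction n)
  case 0
  then show ?case using sqrt_bounds[OF assms] by (simp add: sqrt_iter.simps(2))
next
  case (Suc n)
  define l where "l = sqrt (u\<^sup>2 + \<eta>\<^sup>2)"
  have b: "\<eta> \<le> l" "l \<le> 1" using sqrt_bounds[OF assms] by (auto simp: l_def)
  have le: "sqrt_iter \<eta> (Suc n) u \<le> l - \<eta>"
  proof -
    have "0 \<le> ((l - \<eta>) - sqrt_iter \<eta> n u) * (1 - (l + (sqrt_iter \<eta> n u + \<eta>)) / 2)"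
      using Suc b unfolding l_def[symmetric] by (intro mult_nonneg_nonneg) auto
    then show ?thesis using sqrt_iter_step[of u n] unfolding l_def by linarith
  qed
  have ge: "0 \<le> sqrt_iter \<eta> (Suc n) u" using Suc by linarith
  have "sqrt_iter \<eta> (Suc n) u \<le> sqrt_iter \<eta> (Suc (Suc n)) u"
  proof -
    have "l - \<eta> - sqrt_iter \<eta> (Suc (Suc n)) u
        = (l - \<eta> - sqrt_iter \<eta> (Suc n) u) * (1 - (l + (sqrt_iter \<eta> (Suc n) u + \<eta>)) / 2)"
      unfolding l_def by (rule sqrt_iter_step)
    also have "\<dots> \<le> (l - \<eta> - sqrt_iter \<eta> (Suc n) u) * 1"
      using le ge b \<eta> by (intro mult_left_mono) auto
    finally show ?thesis by simp
  qed
  with le ge show ?case by (simp add: l_def)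
qed

lemma sqrt_iter_limit:
  assumes "\<bar>u\<bar> \<le> 1 / 2"
  shows "(\<lambda>n. sqrt_iter \<eta> n u) \<longlonglongrightarrow> sqrt (u\<^sup>2 + \<eta>\<^sup>2) - \<eta>"
proof -
  define l where "l = sqrt (u\<^sup>2 + \<eta>\<^sup>2)"
  have b: "\<eta> \<le> l" "l \<le> 1" using sqrt_bounds[OF assms] by (auto simp: l_def)
  have bd: "0 \<le> sqrt_iter \<eta> n u" "sqrt_iter \<eta> n u \<le> l - \<eta>" for n
    using sqrt_iter_bounds[OF assms, of n] by (auto simp: l_def)
  have "(l - \<eta>) - sqrt_iter \<eta> n u \<le> (1 - \<eta>) ^ n" for n
  proof (induction n)
    case 0
    then show ?case using b \<eta> by simp
  next
    case (Suc n)
    have "(l - \<eta>) - sqrt_iter \<eta> (Suc n) u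
        = ((l - \<eta>) - sqrt_iter \<eta> n u) * (1 - (l + (sqrt_iter \<eta> n u + \<eta>)) / 2)"
      using sqrt_iter_step[of u n] unfolding l_def .
    also have "\<dots> \<le> (1 - \<eta>) ^ n * (1 - \<eta>)"
      using Suc b bd[of n] \<eta> by (intro mult_mono) auto
    finally show ?case by (simp add: mult.commute)
  qed
  then have close: "norm (sqrt_iter \<eta> n u - (l - \<eta>)) \<le> (1 - \<eta>) ^ n" for n
    using bd(2)[of n] by (simp add: abs_if) (smt (verit))
  have "(\<lambda>n. (1 - \<eta>) ^ n) \<longlonglongrightarrow> 0"
    using \<eta> by (intro LIMSEQ_power_zero) auto
  then have "(\<lambda>n. sqrt_iter \<eta> n u - (l - \<eta>)) \<longlonglongrightarrow> 0"
    by (rule Lim_null_comparison[OF always_eventually[OF allI[OF close]]])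
  then show ?thesis unfolding l_def by (simp add: LIM_zero_iff)
qed

text \<open>The constant \<open>1 / \<eta>\<close> reproduces itself: one step contracts differences of the previous iterate by
  \<open>1 - \<eta>\<close> and adds at most the difference of the arguments.\<close>

lemma sqrt_iter_lipschitz: "(1 / \<eta>)-lipschitz_on {-(1/2)..1/2} (sqrt_iter \<eta> n)"
proof (induction n)
  case 0
  then show ?case using \<eta> by (intro lipschitz_onI) auto
next
  case (Suc n)
  show ?case
  proof (rule lipschitz_onI)
    fix u v :: real assume "u \<in> {-(1/2)..1/2}" "v \<in> {-(1/2)..1/2}"
    then have uv: "\<bar>u\<bar> \<le> 1 / 2" "\<bar>v\<bar> \<le> 1 / 2" by (auto simp: abs_le_iff)
    define p q where "p = sqrt_iter \<eta> n u" and "q = sqrt_iter \<eta> n v"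
    have pq: "0 \<le> p" "p + \<eta> \<le> 1" "0 \<le> q" "q + \<eta> \<le> 1"
      using sqrt_iter_bounds[OF uv(1), of n] sqrt_iter_bounds[OF uv(2), of n]
        sqrt_bounds(2)[OF uv(1)] sqrt_bounds(2)[OF uv(2)]
      unfolding p_def[symmetric] q_def[symmetric] by linarith+
    have IH: "\<bar>p - q\<bar> \<le> 1 / \<eta> * \<bar>u - v\<bar>"
      using lipschitz_onD[OF Suc, of u v] \<open>u \<in> _\<close> \<open>v \<in> _\<close>
      by (simp add: p_def q_def dist_real_def)
    have "sqrt_iter \<eta> (Suc n) u - sqrt_iter \<eta> (Suc n) v
        = (1 - \<eta> - (p + q) / 2) * (p - q) + (u + v) / 2 * (u - v)"
      by (simp add: sqrt_iter.simps(2) p_def q_def field_simps power2_eq_square)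
    then have "\<bar>sqrt_iter \<eta> (Suc n) u - sqrt_iter \<eta> (Suc n) v\<bar>
        \<le> \<bar>1 - \<eta> - (p + q) / 2\<bar> * \<bar>p - q\<bar> + \<bar>(u + v) / 2\<bar> * \<bar>u - v\<bar>"
      by (metis abs_mult abs_triangle_ineq)
    also have "\<dots> \<le> (1 - \<eta>) * (1 / \<eta> * \<bar>u - v\<bar>) + 1 * \<bar>u - v\<bar>"
      using pq IH uv \<eta> by (intro add_mono mult_mono) (auto simp: abs_le_iff)
    also have "\<dots> = 1 / \<eta> * \<bar>u - v\<bar>"
      using \<eta> by (simp add: field_simps)
    finally show "dist (sqrt_iter \<eta> (Suc n) u) (sqrt_iter \<eta> (Suc n) v) \<le> 1 / \<eta> * dist u v"
      by (simp add: dist_real_def)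
  qed (use \<eta> in simp)
qed

end

text \<open>The triangle inequality for the points \<open>(u, \<eta>)\<close> and \<open>(v, \<eta>)\<close> of the plane. The constant does not
  depend on \<open>\<eta>\<close>, unlike that of the iterates.\<close>

lemma sqrt_lipschitz: "1-lipschitz_on S (\<lambda>u :: real. sqrt (u\<^sup>2 + \<eta>\<^sup>2) - \<eta>)"
proof (rule lipschitz_onI)
  fix u v :: real
  show "dist (sqrt (u\<^sup>2 + \<eta>\<^sup>2) - \<eta>) (sqrt (v\<^sup>2 + \<eta>\<^sup>2) - \<eta>) \<le> 1 * dist u v"
    using real_sqrt_sum_squares_triangle_ineq[of v "u - v" \<eta> 0]
      real_sqrt_sum_squares_triangle_ineq[of u "v - u" \<eta> 0]
    by (auto simp: dist_real_def abs_le_iff)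
qed simp


section \<open>Lattice structure of order complete subalgebras\<close>

lemma order_complete_incseq:
  assumes "lip_order_complete Y" and "\<And>n :: nat. f n \<in> Y" and "\<And>n. norm (f n) \<le> C"
    and "\<And>n x. lip_apply (f n) x \<le> lip_apply (f (Suc n)) x"
    and lim: "\<And>x. (\<lambda>n. lip_apply (f n) x) \<longlonglongrightarrow> h x"
  shows "h \<in> lip_apply ` Y"
proof -
  define r :: "nat rel" where "r = {(m, n). m \<le> n}"
  have dir: "directed_by UNIV r"
    unfolding directed_by_def preorder_on_def refl_on_def
    by (auto simp: r_def trans_def trans_on_def intro: max.cobounded1 max.cobounded2)
  have "net_filter UNIV r = sequentially"
    by (intro filter_eq_iff[THEN iffD2] allI, subst eventually_net_filter[OF dir])
      (auto simp: eventually_sequentially r_def)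
  then show ?thesis
    using assms(1) dir assms(2,3)
  proof (rule_tac lip_order_completeD[where I = UNIV and r = r and f = f and C = C])
    fix i j x assume "(i, j) \<in> r"
    then show "lip_apply (f i) x \<le> lip_apply (f j) x"
      using lift_Suc_mono_le[of "\<lambda>n. lip_apply (f n) x" i j] assms(4) by (simp add: r_def)
  qed (use lim in auto)
qed

locale order_complete_subalgebra = lip_gauge +
  fixes Y :: "'a :: {metric_space, zero} lip0 set"
  assumes sub: "subspace Y" and prod: "f \<in> Y \<Longrightarrow> g \<in> Y \<Longrightarrow> lip_prod \<alpha> f g \<in> Y"
    and complete: "lip_order_complete Y"
begin

text \<open>Two increasing limits with bounded norms: for fixed \<open>\<eta>\<close> the polynomials \<open>sqrt_iter \<eta> n\<close> lead to
  \<open>sqrt (u\<^sup>2 + \<eta>\<^sup>2) - \<eta>\<close>, and as \<open>\<eta>\<close> decreases to \<open>0\<close> these functions increase to \<open>\<bar>u\<bar>\<close>. The smallness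
  of \<open>f\<close> places the quotient \<open>u = f / \<zeta>\<close> in the interval on which the iteration is controlled.\<close>

lemma abs_mem_small:
  assumes f: "f \<in> Y" and small: "D * norm f \<le> 1 / 2"
  shows "(\<lambda>x. \<bar>lip_apply f x\<bar>) \<in> lip_apply ` Y"
proof -
  define u where "u x = lip_apply f x / gauge_zeta \<alpha> x" for x
  have u: "\<bar>u x\<bar> \<le> 1 / 2" for x
    using ratio_bound[of f x] small unfolding u_def by linarith
  define S where "S \<eta> = calc (\<lambda>t. sqrt (t\<^sup>2 + \<eta>\<^sup>2) - \<eta>) f" for \<eta> :: real
  have S: "lip_apply (S \<eta>) x = gauge_zeta \<alpha> x * (sqrt ((u x)\<^sup>2 + \<eta>\<^sup>2) - \<eta>)"
    "norm (S \<eta>) \<le> 1 * (norm f + 2 * (1 / 2) * L)" if "0 < \<eta>" for \<eta> x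
    using lip_apply_calc[OF sqrt_lipschitz _ small, of \<eta> x]
      norm_calc_le[OF sqrt_lipschitz _ small, of \<eta>] that by (auto simp: S_def u_def)
  have S_mem: "S \<eta> \<in> Y" if \<eta>: "0 < \<eta>" "\<eta> \<le> 1 / 2" for \<eta>
  proof -
    define b where "b n = calc (sqrt_iter \<eta> n) f" for n
    have b: "lip_apply (b n) x = gauge_zeta \<alpha> x * sqrt_iter \<eta> n (u x)" for n x
      unfolding b_def u_def by (intro lip_apply_calc[OF sqrt_iter_lipschitz[OF \<eta>] sqrt_iter_zero small])
    have "b n \<in> Y" for n
    proof (induction n)
      case 0
      have "b 0 = 0" by (intro lip0_eqI) (simp add: b)
      then show ?case using subspace_0[OF sub] by simp
    next
      case (Suc n)
      have "b (Suc n) = (1 - \<eta>) *\<^sub>R b n + (1 / 2) *\<^sub>R (lip_prod \<alpha> f f - lip_prod \<alpha> (b n) (b n))"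
      proof (rule lip0_eqI)
        fix x
        show "lip_apply (b (Suc n)) x = lip_apply ((1 - \<eta>) *\<^sub>R b n +
            (1 / 2) *\<^sub>R (lip_prod \<alpha> f f - lip_prod \<alpha> (b n) (b n))) x"
          using zeta_pos[of x]
          by (cases "x = 0") (auto simp: b sqrt_iter.simps(2) lip_apply_prod u_def field_simps power2_eq_square)
      qed
      then show ?case
        using Suc f by (simp add: subspace_add[OF sub] subspace_diff[OF sub] subspace_scale[OF sub] prod)
    qed
    then have "lip_apply (S \<eta>) \<in> lip_apply ` Y"
    proof (rule order_complete_incseq[OF complete])
      show "norm (b n) \<le> 1 / \<eta> * (norm f + 2 * (1 / 2) * L)" for n
        unfolding b_def by (rule norm_calc_le[OF sqrt_iter_lipschitz[OF \<eta>] sqrt_iter_zero small])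
      show "lip_apply (b n) x \<le> lip_apply (b (Suc n)) x" for n x
        unfolding b using sqrt_iter_bounds[OF \<eta> u] zeta_nonneg by (blast intro: mult_left_mono)
      show "(\<lambda>n. lip_apply (b n) x) \<longlonglongrightarrow> lip_apply (S \<eta>) x" for x
        unfolding b S(1)[OF \<eta>(1)] by (intro tendsto_mult tendsto_const sqrt_iter_limit[OF \<eta> u])
    qed
    then show ?thesis by (auto simp: lip_apply_inject)
  qed
  define \<eta> where "\<eta> n = inverse (real (Suc (Suc n)))" for n
  have \<eta>: "0 < \<eta> n" "\<eta> n \<le> 1 / 2" "\<eta> (Suc n) \<le> \<eta> n" for n
    by (auto simp: \<eta>_def field_simps)
  have \<eta>0: "\<eta> \<longlonglongrightarrow> 0"
    using LIMSEQ_Suc[OF LIMSEQ_inverse_real_of_nat] unfolding \<eta>_def .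
  show ?thesis
  proof (rule order_complete_incseq[OF complete])
    show "S (\<eta> n) \<in> Y" for n using S_mem \<eta> by blast
    show "norm (S (\<eta> n)) \<le> 1 * (norm f + 2 * (1 / 2) * L)" for n using S(2) \<eta> by blast
    show "lip_apply (S (\<eta> n)) x \<le> lip_apply (S (\<eta> (Suc n))) x" for n x
      unfolding S(1)[OF \<eta>(1)]
      using real_sqrt_sum_squares_triangle_ineq[of "u x" 0 "\<eta> (Suc n)" "\<eta> n - \<eta> (Suc n)"] \<eta>(3)[of n]
      by (intro mult_left_mono zeta_nonneg) auto
    show "(\<lambda>n. lip_apply (S (\<eta> n)) x) \<longlonglongrightarrow> \<bar>lip_apply f x\<bar>" for x
    proof -
      have "(\<lambda>n. gauge_zeta \<alpha> x * (sqrt ((u x)\<^sup>2 + (\<eta> n)\<^sup>2) - \<eta> n))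
          \<longlonglongrightarrow> gauge_zeta \<alpha> x * (sqrt ((u x)\<^sup>2 + 0\<^sup>2) - 0)"
        by (intro tendsto_intros \<eta>0)
      moreover have "gauge_zeta \<alpha> x * (sqrt ((u x)\<^sup>2 + 0\<^sup>2) - 0) = \<bar>lip_apply f x\<bar>"
        using zeta_pos[of x] by (cases "x = 0") (auto simp: u_def abs_div)
      ultimately show ?thesis by (simp add: S(1)[OF \<eta>(1)])
    qed
  qed
qed

lemma abs_mem:
  assumes f: "f \<in> Y"
  shows "(\<lambda>x. \<bar>lip_apply f x\<bar>) \<in> lip_apply ` Y"
proof -
  define c where "c = 1 / (2 * (D * norm f + 1))"
  have p: "0 < D * norm f + 1" by (intro add_nonneg_pos mult_nonneg_nonneg D_nonneg) auto
  then have c: "0 < c" by (simp add: c_def)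
  have "D * norm (c *\<^sub>R f) \<le> 1 / 2"
    using p c by (simp add: c_def field_simps)
  then obtain g where g: "g \<in> Y" "\<And>x. lip_apply g x = \<bar>lip_apply (c *\<^sub>R f) x\<bar>"
    using abs_mem_small[OF subspace_scale[OF sub f, of c]] by (metis imageE)
  have "lip_apply (g /\<^sub>R c) = (\<lambda>x. \<bar>lip_apply f x\<bar>)"
    using c by (auto simp: g(2) abs_mult)
  then show ?thesis
    using subspace_scale[OF sub g(1), of "inverse c"] by (metis image_eqI)
qed

lemma max_mem:
  assumes "f \<in> Y" "g \<in> Y"
  obtains h where "h \<in> Y" "\<And>x. lip_apply h x = max (lip_apply f x) (lip_apply g x)"
proof -
  obtain k where k: "k \<in> Y" "lip_apply k = (\<lambda>x. \<bar>lip_apply (f - g) x\<bar>)"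
    using abs_mem[OF subspace_diff[OF sub assms]] by force
  show ?thesis
  proof
    show "(1 / 2) *\<^sub>R (f + g + k) \<in> Y"
      using assms k by (intro subspace_scale[OF sub] subspace_add[OF sub])
    show "lip_apply ((1 / 2) *\<^sub>R (f + g + k)) x = max (lip_apply f x) (lip_apply g x)" for x
      by (auto simp: k(2) max_def abs_if field_simps)
  qed
qed

lemma Max_mem:
  assumes "finite A" "A \<noteq> {}" "A \<subseteq> Y" "\<And>f. f \<in> A \<Longrightarrow> norm f \<le> C"
  shows "\<exists>h\<in>Y. norm h \<le> C \<and> (\<forall>x. lip_apply h x = (MAX f\<in>A. lip_apply f x))"
  using assms
proof (induction rule: finite_ne_induct)
  case (singleton f)
  then show ?case by auto
next
  case (insert f A)
  then obtain k where k: "k \<in> Y" "norm k \<le> C" "\<And>x. lip_apply k x = (MAX f\<in>A. lip_apply f x)" by auto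
  obtain h where h: "h \<in> Y" "\<And>x. lip_apply h x = max (lip_apply f x) (lip_apply k x)"
    using max_mem[of f k] insert.prems k(1) by blast
  have fC: "norm f \<le> C" using insert.prems by simp
  have "norm h \<le> C"
  proof (rule norm_lip0_leI)
    show "0 \<le> C" using fC by (meson norm_ge_zero order_trans)
    fix x y :: 'a
    have "\<bar>lip_apply g x - lip_apply g y\<bar> \<le> C * dist x y" if "norm g \<le> C" for g :: "'a lip0"
      using lip0_diff_le[of g x y] mult_right_mono[OF that, of "dist x y"] by simp
    from this[OF fC] this[OF k(2)] show "\<bar>lip_apply h x - lip_apply h y\<bar> \<le> C * dist x y"
      unfolding h(2) by (auto simp: max_def abs_le_iff)
  qed
  moreover have "lip_apply h x = (MAX f\<in>insert f A. lip_apply f x)" for x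
    using insert.hyps by (simp add: h(2) k(3))
  ultimately show ?case using h(1) by blast
qed

text \<open>The suprema of the finite subsets of \<open>S\<close> form an increasing net, and a maximum of functions with
  norm at most \<open>C\<close> has norm at most \<open>C\<close>.\<close>

lemma SUP_mem:
  assumes S: "S \<subseteq> Y" "S \<noteq> {}" and C: "\<And>f. f \<in> S \<Longrightarrow> norm f \<le> C"
  shows "(\<lambda>x. SUP f\<in>S. lip_apply f x) \<in> lip_apply ` Y"
proof -
  define I where "I = {A. finite A \<and> A \<noteq> {} \<and> A \<subseteq> S}"
  define r where "r = {(A, B). A \<in> I \<and> B \<in> I \<and> A \<subseteq> B}"
  have "\<exists>h. h \<in> Y \<and> norm h \<le> C \<and> (\<forall>x. lip_apply h x = (MAX f\<in>A. lip_apply f x))" if "A \<in> I" for A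
    using Max_mem[of A C] that S C unfolding I_def by blast
  then obtain m where m: "\<And>A. A \<in> I \<Longrightarrow> m A \<in> Y" "\<And>A. A \<in> I \<Longrightarrow> norm (m A) \<le> C"
    "\<And>A x. A \<in> I \<Longrightarrow> lip_apply (m A) x = (MAX f\<in>A. lip_apply f x)"
    by metis
  have bdd: "bdd_above ((\<lambda>f. lip_apply f x) ` S)" for x
  proof (rule bdd_aboveI2)
    fix f assume "f \<in> S"
    then show "lip_apply f x \<le> C * dist x 0"
      using lip0_diff_le[of f x 0] mult_right_mono[OF C, of f "dist x 0"] by auto
  qed
  have dir: "directed_by I r"
    unfolding directed_by_def
  proof (intro conjI ballI)
    obtain f where "f \<in> S" using S by blast
    then have "{f} \<in> I" by (simp add: I_def)
    then show "I \<noteq> {}" by blast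
    show "preorder_on I r"
      unfolding preorder_on_def refl_on_def by (auto simp: r_def trans_def trans_on_def)
    show "\<exists>K\<in>I. (A, K) \<in> r \<and> (B, K) \<in> r" if "A \<in> I" "B \<in> I" for A B
      using that by (intro bexI[of _ "A \<union> B"]) (auto simp: I_def r_def)
  qed
  have m_mono: "lip_apply (m A) x \<le> lip_apply (m B) x" if "A \<in> I" "B \<in> I" "(A, B) \<in> r" for A B x
    using that by (auto simp: m(3) I_def r_def intro!: Max_mono)
  show ?thesis
  proof (rule lip_order_completeD[OF complete dir, of m C])
    fix x
    show "((\<lambda>A. lip_apply (m A) x) \<longlongrightarrow> (SUP f\<in>S. lip_apply f x)) (net_filter I r)"
    proof (rule tendstoI)
      fix e :: real assume e: "0 < e"
      obtain f where f: "f \<in> S" "(SUP f\<in>S. lip_apply f x) - e < lip_apply f x"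
        using less_cSUP_iff[OF S(2) bdd, of "(SUP f\<in>S. lip_apply f x) - e" x] e by auto
      have "\<forall>A\<in>I. ({f}, A) \<in> r \<longrightarrow> dist (lip_apply (m A) x) (SUP f\<in>S. lip_apply f x) < e"
      proof (intro ballI impI)
        fix A assume A: "A \<in> I" "({f}, A) \<in> r"
        then have "lip_apply f x \<le> lip_apply (m A) x"
          by (auto simp: m(3) I_def r_def)
        moreover have "lip_apply (m A) x \<le> (SUP f\<in>S. lip_apply f x)"
          using A bdd by (auto simp: m(3) I_def intro!: cSUP_upper)
        ultimately show "dist (lip_apply (m A) x) (SUP f\<in>S. lip_apply f x) < e"
          using f(2) by (simp add: dist_real_def)
      qed
      then show "\<forall>\<^sub>F A in net_filter I r. dist (lip_apply (m A) x) (SUP f\<in>S. lip_apply f x) < e"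
        unfolding eventually_net_filter[OF dir] using f(1) by (intro bexI[of _ "{f}"]) (auto simp: I_def)
    qed
  qed (use m m_mono in auto)
qed

lemma INF_mem:
  assumes S: "S \<subseteq> Y" "S \<noteq> {}" and C: "\<And>f. f \<in> S \<Longrightarrow> norm f \<le> C"
  shows "(\<lambda>x. INF f\<in>S. lip_apply f x) \<in> lip_apply ` Y"
proof -
  have "(\<lambda>x. SUP f\<in>uminus ` S. lip_apply f x) \<in> lip_apply ` Y"
    using assms subspace_neg[OF sub] by (intro SUP_mem[where C = C]) auto
  then obtain g where g: "g \<in> Y" "\<And>x. lip_apply g x = (SUP f\<in>uminus ` S. lip_apply f x)"
    by (metis imageE)
  have "lip_apply (- g) = (\<lambda>x. INF f\<in>S. lip_apply f x)"
    by (auto simp: g(2) image_image Inf_real_def)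
  then show ?thesis using subspace_neg[OF sub g(1)] by (metis image_eqI)
qed

text \<open>A point \<open>h\<close> of the pointwise closure is a lower limit: it is the supremum, over the open
  neighbourhoods \<open>U\<close> of \<open>h\<close>, of the infimum of all functions of the bounded part of \<open>Y\<close> that lie in \<open>U\<close>.
  Both operations stay in a complete sublattice.\<close>

lemma closed_pointwise_bounded: "closed (lip_apply ` {g \<in> Y. norm g \<le> C})" (is "closed ?S")
proof -
  have "h \<in> ?S" if h: "h \<in> closure ?S" for h
  proof -
    have meet: "U \<inter> ?S \<noteq> {}" if "open U" "h \<in> U" for U
      using h that closure_iff_nhds_not_empty by blast
    define N where "N = {U. open U \<and> h \<in> U}"
    define A where "A U = {g \<in> Y. norm g \<le> C \<and> lip_apply g \<in> U}" for U
    have A_ne: "A U \<noteq> {}" if "U \<in> N" for U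
      using meet[of U] that by (auto simp: N_def A_def)
    have C0: "0 \<le> C"
      using A_ne[of UNIV] by (auto simp: N_def A_def intro: order_trans[OF norm_ge_zero])
    have lipC: "\<bar>lip_apply g x - lip_apply g y\<bar> \<le> C * dist x y" if "g \<in> A U" for g U x y
      using lip0_diff_le[of g x y] mult_right_mono[of "norm g" C "dist x y"] that by (simp add: A_def)
    have bdd: "bdd_below ((\<lambda>g. lip_apply g x) ` A U)" for x U
    proof (rule bdd_belowI2)
      show "- (C * dist x 0) \<le> lip_apply g x" if "g \<in> A U" for g
        using lipC[OF that, of x 0] by (simp add: abs_le_iff)
    qed
    have "\<exists>k. k \<in> Y \<and> (\<forall>x. lip_apply k x = (INF g\<in>A U. lip_apply g x))" if "U \<in> N" for U
    proof -
      have "(\<lambda>x. INF g\<in>A U. lip_apply g x) \<in> lip_apply ` Y"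
        using A_ne[OF that] by (intro INF_mem[where C = C]) (auto simp: A_def)
      then show ?thesis by (metis imageE)
    qed
    then obtain k where k: "\<And>U. U \<in> N \<Longrightarrow> k U \<in> Y"
      "\<And>U x. U \<in> N \<Longrightarrow> lip_apply (k U) x = (INF g\<in>A U. lip_apply g x)"
      by metis
    have k_norm: "norm (k U) \<le> C" if U: "U \<in> N" for U
    proof (rule norm_lip0_leI[OF C0])
      fix x y
      have *: "lip_apply (k U) x \<le> lip_apply (k U) y + C * dist x y" for x y
      proof -
        have "lip_apply (k U) x - C * dist x y \<le> (INF g\<in>A U. lip_apply g y)"
        proof (rule cINF_greatest[OF A_ne[OF U]])
          fix g assume g: "g \<in> A U"
          have "lip_apply (k U) x \<le> lip_apply g x"
            unfolding k(2)[OF U] using g bdd by (intro cINF_lower)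
          with lipC[OF g, of x y] show "lip_apply (k U) x - C * dist x y \<le> lip_apply g y" by linarith
        qed
        then show ?thesis by (simp add: k(2)[OF U])
      qed
      from *[of x y] *[of y x] show "\<bar>lip_apply (k U) x - lip_apply (k U) y\<bar> \<le> C * dist x y"
        by (simp add: dist_commute abs_le_iff)
    qed
    define V where "V x e = {f :: 'a \<Rightarrow> real. \<bar>f x - h x\<bar> < e}" for x e
    have V: "open (V x e)" for x e
      unfolding V_def
      by (intro open_Collect_less continuous_intros continuous_on_product_coordinates)
    have k_le: "lip_apply (k U) x \<le> h x" if U: "U \<in> N" for U x
    proof (rule field_le_epsilon)
      fix e :: real assume e: "0 < e"
      then have "U \<inter> V x e \<in> N" using U V by (auto simp: N_def V_def)
      then obtain g where g: "g \<in> A (U \<inter> V x e)" using A_ne by blast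
      have "lip_apply (k U) x \<le> lip_apply g x"
        unfolding k(2)[OF U] using g bdd by (intro cINF_lower) (auto simp: A_def)
      with g show "lip_apply (k U) x \<le> h x + e" by (auto simp: A_def V_def)
    qed
    have UN: "UNIV \<in> N" by (simp add: N_def)
    have sup: "(SUP f\<in>k ` N. lip_apply f x) = h x" for x
    proof (rule antisym)
      show "(SUP f\<in>k ` N. lip_apply f x) \<le> h x"
        using k_le UN by (intro cSUP_least) auto
      show "h x \<le> (SUP f\<in>k ` N. lip_apply f x)"
      proof (rule field_le_epsilon)
        fix e :: real assume e: "0 < e"
        then have VN: "V x e \<in> N" using V by (auto simp: N_def V_def)
        have "h x - e \<le> lip_apply (k (V x e)) x"
          unfolding k(2)[OF VN]
          by (rule cINF_greatest[OF A_ne[OF VN]]) (auto simp: A_def V_def)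
        also have "\<dots> \<le> (SUP f\<in>k ` N. lip_apply f x)"
          using VN k_le by (intro cSUP_upper bdd_aboveI2[of _ _ "h x"]) auto
        finally show "h x \<le> (SUP f\<in>k ` N. lip_apply f x) + e" by simp
      qed
    qed
    have "(\<lambda>x. SUP f\<in>k ` N. lip_apply f x) \<in> lip_apply ` Y"
      using k(1) k_norm UN by (intro SUP_mem[where C = C]) auto
    then obtain g where g: "g \<in> Y" "h = lip_apply g" by (auto simp: sup)
    have "norm g \<le> C"
    proof (rule norm_lip0_leI[OF C0], rule field_le_epsilon)
      fix x y and e :: real assume e: "0 < e"
      have "V x (e / 2) \<inter> V y (e / 2) \<in> N"
        using open_Int[OF V V, of x "e / 2" y "e / 2"] e by (simp add: N_def) (simp add: V_def)
      then obtain f where f: "f \<in> A (V x (e / 2) \<inter> V y (e / 2))" using A_ne by blast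
      then have "\<bar>lip_apply f x - h x\<bar> < e / 2" "\<bar>lip_apply f y - h y\<bar> < e / 2"
        by (auto simp: A_def V_def)
      with lipC[OF f, of x y] show "\<bar>lip_apply g x - lip_apply g y\<bar> \<le> C * dist x y + e"
        unfolding g(2) by linarith
    qed
    with g show ?thesis by blast
  qed
  then show ?thesis
    using closure_subset_eq by blast
qed

text \<open>With \<open>v = max 0 f\<close> and \<open>z = c \<zeta>\<close>, the function \<open>max 0 (v - z)\<close> is the lower envelope of the functions
  \<open>max 0 ((v - z) + (k v - z)\<^sup>2 / z)\<close> for \<open>0 \<le> k \<le> 1\<close>. For \<open>k > 0\<close> the quadratic expression
  is the parabola through the origin tangent to \<open>v - z\<close> at \<open>v = z / k\<close>. The constant term cancels, so the expression equals
  \<open>(1 - 2 k) v + (k\<^sup>2 / c) (v \<odot>\<^sub>\<alpha> v)\<close> and belongs to the subalgebra. The norms are bounded uniformly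
  in \<open>k\<close>, so completeness of the lattice applies.\<close>

lemma truncation_mem:
  assumes f: "f \<in> Y" and c: "0 \<le> c"
  shows "(\<lambda>x. max 0 (lip_apply f x - c * gauge_zeta \<alpha> x)) \<in> lip_apply ` Y"
proof -
  obtain v where v: "v \<in> Y" "\<And>x. lip_apply v x = max 0 (lip_apply f x)"
    using max_mem[OF subspace_0[OF sub] f] by auto
  show ?thesis
  proof (cases "c = 0")
    case True
    then have "lip_apply v = (\<lambda>x. max 0 (lip_apply f x - c * gauge_zeta \<alpha> x))"
      by (simp add: fun_eq_iff v(2))
    then show ?thesis using v(1) by (metis image_eqI)
  next
    case False
    with c have c: "0 < c" by simp
    define q where "q k = (1 - 2 * k) *\<^sub>R v + (k\<^sup>2 / c) *\<^sub>R lip_prod \<alpha> v v" for k :: real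
    have q_mem: "q k \<in> Y" for k
      unfolding q_def using v(1) prod by (intro subspace_add[OF sub] subspace_scale[OF sub])
    have "\<exists>g. g \<in> Y \<and> (\<forall>x. lip_apply g x = max 0 (lip_apply (q k) x))" for k
      using max_mem[OF subspace_0[OF sub] q_mem[of k]] by (metis lip_apply_zero)
    then obtain g where g: "\<And>k. g k \<in> Y" "\<And>k x. lip_apply (g k) x = max 0 (lip_apply (q k) x)"
      by metis
    define C where "C = norm v + norm (lip_prod \<alpha> v v) / c"
    have C: "norm (g k) \<le> C" if k: "k \<in> {0..1}" for k
    proof (rule norm_lip0_leI)
      show "0 \<le> C" using c by (simp add: C_def)
      have "norm (q k) \<le> \<bar>1 - 2 * k\<bar> * norm v + \<bar>k\<^sup>2 / c\<bar> * norm (lip_prod \<alpha> v v)"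
        unfolding q_def by (metis norm_scaleR norm_triangle_ineq)
      also have "\<dots> \<le> 1 * norm v + 1 / c * norm (lip_prod \<alpha> v v)"
        using k c by (intro add_mono mult_right_mono) (auto simp: divide_right_mono power_le_one)
      finally have "norm (q k) \<le> C" by (simp add: C_def)
      fix x y
      have "\<bar>lip_apply (g k) x - lip_apply (g k) y\<bar> \<le> \<bar>lip_apply (q k) x - lip_apply (q k) y\<bar>"
        unfolding g(2) by (auto simp: max_def abs_if)
      also have "\<dots> \<le> norm (q k) * dist x y" by (rule lip0_diff_le)
      also have "\<dots> \<le> C * dist x y" using \<open>norm (q k) \<le> C\<close> by (rule mult_right_mono) simp
      finally show "\<bar>lip_apply (g k) x - lip_apply (g k) y\<bar> \<le> C * dist x y" .
    qed
    have "(INF f\<in>g ` {0..1}. lip_apply f x) = max 0 (lip_apply f x - c * gauge_zeta \<alpha> x)" for x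
    proof (cases "x = 0")
      case False
      define z where "z = c * gauge_zeta \<alpha> x"
      have z: "0 < z" using c zeta_pos[OF False] by (simp add: z_def)
      define w where "w = lip_apply v x"
      have w: "0 \<le> w" by (simp add: w_def v(2))
      have gx: "lip_apply (g k) x = max 0 ((w - z) + (k * w - z)\<^sup>2 / z)" for k
        using c z zeta_pos[OF False]
        by (simp add: g(2) q_def lip_apply_prod w_def[symmetric] z_def field_simps power2_eq_square)
      have "(INF k\<in>{0..1}. lip_apply (g k) x) = max 0 (w - z)"
      proof (rule cInf_eq_minimum)
        \<comment> \<open>The parabola touches at \<open>v = w\<close>; for \<open>w < z\<close> the one with \<open>k = 1\<close> is already nonpositive.\<close>
        define k where "k = (if z \<le> w then z / w else 1)"
        have "k \<in> {0..1}" using z w by (auto simp: k_def)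
        moreover have "lip_apply (g k) x = max 0 (w - z)"
        proof (cases "z \<le> w")
          case True
          then show ?thesis using z by (simp add: gx k_def)
        next
          case False
          have "(w - z) + (w - z)\<^sup>2 / z = - (w * (z - w) / z)"
            using z by (simp add: field_simps power2_eq_square)
          moreover have "0 \<le> w * (z - w) / z" using w z False by simp
          ultimately show ?thesis using False by (simp add: gx k_def)
        qed
        ultimately show "max 0 (w - z) \<in> (\<lambda>k. lip_apply (g k) x) ` {0..1}" by (metis image_eqI)
        fix y assume "y \<in> (\<lambda>k. lip_apply (g k) x) ` {0..1}"
        then obtain k where "y = max 0 ((w - z) + (k * w - z)\<^sup>2 / z)" using gx by auto
        moreover have "0 \<le> (k * w - z)\<^sup>2 / z" using z by simp
        ultimately show "max 0 (w - z) \<le> y" by simp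
      qed
      moreover have "max 0 (w - z) = max 0 (lip_apply f x - c * gauge_zeta \<alpha> x)"
        using z by (auto simp: w_def z_def v(2) max_def)
      ultimately show ?thesis by (simp add: image_image)
    qed (simp add: image_image)
    moreover have "(\<lambda>x. INF f\<in>g ` {0..1}. lip_apply f x) \<in> lip_apply ` Y"
      using g(1) C by (intro INF_mem[where C = C]) auto
    ultimately show ?thesis by simp
  qed
qed

end


section \<open>Characterisation of order complete subalgebras\<close>

text \<open>Since \<open>gauge_K \<alpha> + 2\<close> is positive, an infinite \<open>gauge_D \<alpha>\<close> would make the product infinite. The bound
  on the quotients \<open>f / \<zeta>\<close>, and with it the functional calculus, rests on this finiteness.\<close>

lemma gauge_D_finite:
  assumes "gauge_D \<alpha> * (gauge_K \<alpha> + 2) \<le> 1"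
  shows "gauge_D \<alpha> < \<infinity>"
proof (rule ccontr)
  assume "\<not> gauge_D \<alpha> < \<infinity>"
  then have "gauge_D \<alpha> = \<infinity>" by (simp add: less_top[symmetric])
  then have "gauge_D \<alpha> * (gauge_K \<alpha> + 2) = \<infinity>" by (simp add: ennreal_top_mult)
  with assms show False by (simp add: top_unique)
qed

theorem theorem5p3:
  fixes \<alpha> :: "real \<Rightarrow> real" and Y :: "'a :: {metric_space, zero} lip0 set"
  assumes "\<And>t. 0 < t \<Longrightarrow> 0 < \<alpha> t"
    and "\<exists>L. L-lipschitz_on {0<..} \<alpha>"
    and "gauge_D \<alpha> * (gauge_K \<alpha> + 2) \<le> 1"
    and "lip_subalgebra \<alpha> Y"
  shows "(lip_order_complete Y \<longleftrightarrow> closedin lip0_weak_star Y) \<and>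
    (lip_order_complete Y \<longrightarrow>
       linear_complete_sublattice Y \<and>
       (has_natural_unit \<alpha> TYPE('a) \<longrightarrow>
          (\<forall>f\<in>Y. \<forall>g\<in>Y. \<forall>c\<ge>0.
             (\<lambda>x. max (lip_apply f x) (lip_apply g x - c * gauge_zeta \<alpha> x)) \<in> lip_apply ` Y)))"
proof -
  obtain L where L: "L-lipschitz_on {0<..} \<alpha>" using assms(2) by blast
  have sub: "subspace Y" and prod: "\<And>f g. f \<in> Y \<Longrightarrow> g \<in> Y \<Longrightarrow> lip_prod \<alpha> f g \<in> Y"
    using assms(4) by (auto simp: lip_subalgebra_def)
  have algebra: "order_complete_subalgebra \<alpha> L Y" if "lip_order_complete Y"
    by standard (use assms(1) L gauge_D_finite[OF assms(3)] sub prod that in auto)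
  have closed: "closedin lip0_weak_star Y" if "lip_order_complete Y"
    by (intro krein_smulian_lip0 sub
        order_complete_subalgebra.closed_pointwise_bounded[OF algebra[OF that]])
  have lattice: "linear_complete_sublattice Y" if oc: "lip_order_complete Y"
    unfolding linear_complete_sublattice_def
    using sub order_complete_subalgebra.SUP_mem[OF algebra[OF oc]] by blast
  have truncated: "(\<lambda>x. max (lip_apply f x) (lip_apply g x - c * gauge_zeta \<alpha> x)) \<in> lip_apply ` Y"
    if oc: "lip_order_complete Y" and fg: "f \<in> Y" "g \<in> Y" and c: "0 \<le> c" for f g c
  proof -
    obtain k where k: "k \<in> Y"
      "lip_apply k = (\<lambda>x. max 0 (lip_apply (g - f) x - c * gauge_zeta \<alpha> x))"
      using order_complete_subalgebra.truncation_mem[OF algebra[OF oc]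
          subspace_diff[OF sub fg(2) fg(1)] c] by force
    have "lip_apply (f + k) = (\<lambda>x. max (lip_apply f x) (lip_apply g x - c * gauge_zeta \<alpha> x))"
      by (auto simp: k(2) max_def)
    then show ?thesis using subspace_add[OF sub fg(1) k(1)] by (metis image_eqI)
  qed
  show ?thesis
    using closed weak_star_closed_imp_order_complete lattice truncated by blast
qed

end
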